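(* Let $n,m\ge 1$ be integers, $d\in\mathbb{N}$, and let $f,g_1,\dots,g_m\in\mathbb{R}_d[x]$, $x=(x_1,\dots,x_n)$. Write $g:=(g_1,\dots,g_m)$. Assume that $f$ is non-negative on $S(g)$ and that $f(C^+(g)\cap S(g))$ is finite. Set $$w:=d\cdot\big(c(n+m+1,\,d+2,\,n+2m+1)-1\big).$$ Let $\bar\lambda:=(\lambda_0,\dots,\lambda_m)$ be a vector of $m+1$ further variables and $$h_{\mathrm{FJ}}^+:=\Big(\lambda_0^2\nabla f-\sum_{j=1}^m \lambda_j^2 \nabla g_j,\ \lambda_1^2g_1,\dots,\lambda_m^2g_m,\ 1-\sum_{j=0}^m\lambda_j^2\Big).$$ Then there exists $q\in \Sigma_w^2[x,\bar \lambda]$ such that $f-q$ vanishes on $(S(g)\times\mathbb{R}^{m+1})\cap V(h_{\mathrm{FJ}}^+)$.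
   Context: Notation. $\mathbb{N}=\{0,1,2,\dots\}$. $\mathbb{R}_d[x]$ is the space of real polynomials in $x$ of degree at most $d$. $S(g):=\{x\in\mathbb{R}^n: g_j(x)\ge 0,\ j=1,\dots,m\}$. For a tuple $h$ of polynomials, $V(h)$ is its set of common real zeros; $\nabla p=(\partial p/\partial x_1,\dots,\partial p/\partial x_n)$, so $h_{\mathrm{FJ}}^+$ consists of $n+m+1$ polynomials in $\mathbb{R}[x,\bar\lambda]$ and $V(h_{\mathrm{FJ}}^+)\subset\mathbb{R}^{n+m+1}$. Polynomials in $x$ are also regarded as polynomials in $(x,\bar\lambda)$. Critical points: let $\varphi^g(x)\in\mathbb{R}^{(n+m)\times m}$ be the matrix whose $j$-th column is $\nabla g_j(x)$ stacked on top of $g_j(x)e_j$ ($e_j$ the $j$-th standard basis vector of $\mathbb{R}^m$). For a real matrix $A$, $\operatorname{rank}^+(A)$ is the largest number of columns of $A$ whose convex hull does not contain $0$. Then $C^+(g):=\{x\in\mathbb{R}^n:\operatorname{rank}^+(\varphi^g(x))<m\}$. $\Sigma^2_w[x,\bar\lambda]$ is the cone of sums of squares of polynomials in $\mathbb{R}[x,\bar\lambda]$ of degree at most $w$. For $n,d,s\in\mathbb{N}$, $c(n,d,s):=d(2d-1)^{n+s-1}$. *)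

theory Defs
  imports "HOL-Analysis.Analysis" "HOL-Library.Poly_Mapping"
begin

text \<open>
  Real polynomials in variables indexed by a finite type \<open>'v\<close>: finitely supported maps from
  exponent vectors to coefficients, with the convolution ring structure of
  \<^theory>\<open>HOL-Library.Poly_Mapping\<close>.
\<close>

type_synonym 'v mpoly = "('v \<Rightarrow>\<^sub>0 nat) \<Rightarrow>\<^sub>0 real"

definition mConst :: "real \<Rightarrow> 'v mpoly" where
  "mConst a = Poly_Mapping.single 0 a"

definition mVar :: "'v \<Rightarrow> 'v mpoly" where
  "mVar v = Poly_Mapping.single (Poly_Mapping.single v 1) 1"

definition meval :: "'v::finite mpoly \<Rightarrow> real ^ 'v \<Rightarrow> real" where
  "meval p x = (\<Sum>k\<in>Poly_Mapping.keys p.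
     Poly_Mapping.lookup p k * (\<Prod>v\<in>UNIV. (x $ v) ^ Poly_Mapping.lookup k v))"

definition polys_deg_le :: "nat \<Rightarrow> 'v::finite mpoly set" where
  "polys_deg_le d =
     {p. \<forall>k\<in>Poly_Mapping.keys p. (\<Sum>v\<in>UNIV. Poly_Mapping.lookup k v) \<le> d}"

text \<open>
  Formal partial derivative. The truncated subtraction of exponents is harmless: where it
  truncates, the coefficient is zero.
\<close>

definition mpderiv :: "'v \<Rightarrow> 'v mpoly \<Rightarrow> 'v mpoly" where
  "mpderiv i p = (\<Sum>k\<in>Poly_Mapping.keys p.
     Poly_Mapping.single (k - Poly_Mapping.single i 1)
       (of_nat (Poly_Mapping.lookup k i) * Poly_Mapping.lookup p k))"

definition sos_deg_le :: "nat \<Rightarrow> 'v::finite mpoly set" where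
  "sos_deg_le w = {q. \<exists>ps. set ps \<subseteq> polys_deg_le w \<and> q = (\<Sum>p\<leftarrow>ps. p ^ 2)}"

definition basic_closed :: "('m \<Rightarrow> 'n::finite mpoly) \<Rightarrow> (real ^ 'n) set" where
  "basic_closed g = {x. \<forall>j. meval (g j) x \<ge> 0}"

definition zero_set :: "('i \<Rightarrow> 'v::finite mpoly) \<Rightarrow> (real ^ 'v) set" where
  "zero_set h = {z. \<forall>i. meval (h i) z = 0}"

text \<open>
  Columns are counted by index, so that equal columns at different positions count separately.
  The empty selection is admissible, hence the maximum is taken over a nonempty set.
\<close>

definition pos_rank :: "real ^ 'c ^ 'r \<Rightarrow> nat" where
  "pos_rank A = Max {card J | J :: 'c set. 0 \<notin> convex hull ((\<lambda>j. column j A) ` J)}"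

definition phi_mat :: "('m::finite \<Rightarrow> 'n::finite mpoly) \<Rightarrow> real ^ 'n \<Rightarrow> real ^ 'm ^ ('n + 'm)" where
  "phi_mat g x = (\<chi> r j. case r of
       Inl i \<Rightarrow> meval (mpderiv i (g j)) x
     | Inr k \<Rightarrow> (meval (g j) x *\<^sub>R axis j 1) $ k)"

definition crit_pos :: "('m::finite \<Rightarrow> 'n::finite mpoly) \<Rightarrow> (real ^ 'n) set" where
  "crit_pos g = {x. pos_rank (phi_mat g x) < CARD('m)}"

text \<open>
  The variables of the extended polynomial ring are indexed by \<open>'n + 'm option\<close>:
  \<open>Inl i\<close> stands for \<open>x\<^sub>i\<close>, \<open>Inr None\<close> for \<open>\<lambda>\<^sub>0\<close> and \<open>Inr (Some j)\<close> for \<open>\<lambda>\<^sub>j\<close>.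
\<close>

definition lam :: "'m option \<Rightarrow> ('n + 'm option) mpoly" where
  "lam j = mVar (Inr j)"

definition lift_x :: "'n::finite mpoly \<Rightarrow> ('n + 'm option) mpoly" where
  "lift_x p = (\<Sum>k\<in>Poly_Mapping.keys p.
     mConst (Poly_Mapping.lookup p k) * (\<Prod>i\<in>UNIV. mVar (Inl i) ^ Poly_Mapping.lookup k i))"

definition x_part :: "real ^ ('n::finite + 'm::finite option) \<Rightarrow> real ^ 'n" where
  "x_part z = (\<chi> i. z $ Inl i)"

definition fritz_john_pos ::
  "'n::finite mpoly \<Rightarrow> ('m::finite \<Rightarrow> 'n mpoly) \<Rightarrow> 'n + 'm + unit \<Rightarrow> ('n + 'm option) mpoly" where
  "fritz_john_pos f g r = (case r of
       Inl i \<Rightarrow> lam None ^ 2 * lift_x (mpderiv i f)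
               - (\<Sum>j\<in>UNIV. lam (Some j) ^ 2 * lift_x (mpderiv i (g j)))
     | Inr (Inl j) \<Rightarrow> lam (Some j) ^ 2 * lift_x (g j)
     | Inr (Inr _) \<Rightarrow> 1 - (\<Sum>j\<in>UNIV. lam j ^ 2))"

text \<open>The truncated subtractions agree with the integer ones whenever \<open>d \<ge> 1\<close> and \<open>n + s \<ge> 1\<close>.\<close>

definition comp_bound :: "nat \<Rightarrow> nat \<Rightarrow> nat \<Rightarrow> nat" where
  "comp_bound n d s = d * (2 * d - 1) ^ (n + s - 1)"

end

theory Submission
  imports Defs
begin

text \<open>
  On the set \<open>W = (S(g) \<times> \<real>\<^sup>m\<^sup>+\<^sup>1) \<inter> V(h)\<close> of Fritz John points the polynomial \<open>f\<close> takes only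
  finitely many values, all of them non-negative, and if there are \<open>k\<close> of them, Lagrange
  interpolation in \<open>f\<close> gives a sum of squares of polynomials of degree \<open>d (k - 1)\<close> that agrees
  with \<open>f\<close> on \<open>W\<close> (\<open>interpolating_sos\<close>). It remains to bound \<open>k\<close>.

  The basic tool is a count of monomials (\<open>algebraic_dependence\<close>): given \<open>N\<close> polynomials \<open>F\<close> of
  degree at most \<open>e\<close> in \<open>N\<close> variables and a further polynomial \<open>f\<close>, there is a nontrivial
  relation \<open>\<Sum> p\<^sub>b(F) f\<^sup>b = 0\<close> with \<open>b \<le> e\<^sup>N\<close>. So if every \<open>t\<close> of a box is attained by \<open>F\<close> at
  points with \<open>k\<close> different values of \<open>f\<close>, then \<open>k \<le> e\<^sup>N\<close> (\<open>values_on_fibres_bound\<close>).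

  Let \<open>V\<close> be the zero set of a non-negative polynomial \<open>G\<close> of degree \<open>e + 1\<close>, and suppose that
  \<open>f\<close> takes at most countably many values on \<open>V\<close>. Then different values are separated by levels
  that miss \<open>V\<close>, and minimising a perturbation of \<open>M G + |z|\<^sup>2\<close> between such levels shows that its
  gradient has the property just described. Hence \<open>f\<close> takes at most \<open>e\<^sup>N\<close> values on \<open>V\<close>
  (\<open>values_on_zero_set_bound\<close>). For \<open>W\<close> this is applied in \<open>N = n + 2 m + 1\<close> variables, slack
  variables for the inequalities included, with \<open>e = 2 d + 3\<close>.

  Countability is where the hypothesis on \<open>C\<^sup>+(g)\<close> enters. A point of \<open>W\<close> with \<open>\<lambda>\<^sub>0 = 0\<close> lies over
  \<open>C\<^sup>+(g)\<close>. A point with \<open>\<lambda>\<^sub>0 \<noteq> 0\<close> gives a critical point of the Lagrangian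
  \<open>f - \<Sum> \<mu>\<^sub>j\<^sup>2 g\<^sub>j\<close> with the same value, and a polynomial \<open>L\<close> has only countably many critical
  values (\<open>countable_critical_values\<close>). To see this, a critical point \<open>x(v)\<close> is selected for each
  critical value \<open>v\<close> as a limit of minimisers of a regularised problem; by the relations above,
  its coordinates are algebraic in \<open>v\<close>. Were there uncountably many critical values, \<open>x\<close> would
  satisfy a Lipschitz estimate along some sequence of them tending to a critical value \<open>v\<^sub>0\<close>, and
  \<open>|v - v\<^sub>0| = |L(x(v)) - L(x(v\<^sub>0))|\<close> would be of smaller order than \<open>|v - v\<^sub>0|\<close> itself.
\<close>

section \<open>Evaluation, degree and derivative of multivariate polynomials\<close>

definition mmono :: "('v \<Rightarrow>\<^sub>0 nat) \<Rightarrow> real ^ 'v::finite \<Rightarrow> real" where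
  "mmono k x = (\<Prod>v\<in>UNIV. (x $ v) ^ Poly_Mapping.lookup k v)"

definition mdeg :: "('v::finite \<Rightarrow>\<^sub>0 nat) \<Rightarrow> nat" where
  "mdeg k = (\<Sum>v\<in>UNIV. Poly_Mapping.lookup k v)"

lemma mmono_add: "mmono (k + l) x = mmono k x * mmono l x"
  by (simp add: mmono_def lookup_add power_add prod.distrib)

lemma mmono_zero [simp]: "mmono 0 x = 1"
  by (simp add: mmono_def)

lemma mdeg_add: "mdeg (k + l) = mdeg k + mdeg l"
  by (simp add: mdeg_def lookup_add sum.distrib)

lemma mdeg_zero [simp]: "mdeg 0 = 0"
  by (simp add: mdeg_def)

lemma mdeg_single: "mdeg (Poly_Mapping.single (v::'v::finite) n) = n"
proof -
  have "mdeg (Poly_Mapping.single v n) = (\<Sum>u\<in>UNIV. if v = u then n else 0)"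
    unfolding mdeg_def by (intro sum.cong refl) (simp add: lookup_single when_def)
  then show ?thesis by simp
qed

lemma mmono_single: "mmono (Poly_Mapping.single (v::'v::finite) n) x = (x $ v) ^ n"
proof -
  have "mmono (Poly_Mapping.single v n) x = (\<Prod>u\<in>UNIV. if v = u then (x $ u) ^ n else 1)"
    unfolding mmono_def by (intro prod.cong refl) (simp add: lookup_single when_def)
  then show ?thesis by simp
qed

lemma meval_superset:
  assumes "finite K" "Poly_Mapping.keys p \<subseteq> K"
  shows "meval p x = (\<Sum>k\<in>K. Poly_Mapping.lookup p k * mmono k x)"
  unfolding meval_def mmono_def [symmetric]
  using assms by (intro sum.mono_neutral_left) (auto simp: in_keys_iff)

lemma meval_single: "meval (Poly_Mapping.single k a) x = a * mmono k x"
  by (subst meval_superset [of "{k}"]) auto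

lemma meval_zero [simp]: "meval 0 x = 0"
  by (simp add: meval_def)

lemma meval_one [simp]: "meval 1 x = 1"
  using meval_single [of 0 1 x] by simp

lemma meval_mConst [simp]: "meval (mConst a) x = a"
  by (simp add: mConst_def meval_single)

lemma meval_mVar [simp]: "meval (mVar v) x = x $ v"
  by (simp add: mVar_def meval_single mmono_single)

lemma meval_add [simp]: "meval (p + q) x = meval p x + meval q x"
proof -
  let ?K = "Poly_Mapping.keys p \<union> Poly_Mapping.keys q"
  have "meval (p + q) x = (\<Sum>k\<in>?K. Poly_Mapping.lookup (p + q) k * mmono k x)"
    using keys_add [of p q] by (intro meval_superset) auto
  also have "\<dots> = (\<Sum>k\<in>?K. Poly_Mapping.lookup p k * mmono k x)
      + (\<Sum>k\<in>?K. Poly_Mapping.lookup q k * mmono k x)"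
    by (simp add: lookup_add algebra_simps sum.distrib)
  also have "\<dots> = meval p x + meval q x"
    by (simp add: meval_superset [of ?K])
  finally show ?thesis .
qed

lemma meval_uminus [simp]: "meval (- p) x = - meval p x"
  using meval_add [of p "- p" x] by simp

lemma meval_diff [simp]: "meval (p - q) x = meval p x - meval q x"
  using meval_add [of p "- q" x] by simp

lemma meval_sum [simp]: "meval (\<Sum>i\<in>I. p i) x = (\<Sum>i\<in>I. meval (p i) x)"
  by (induction I rule: infinite_finite_induct) auto

lemma mpoly_sum_monomials:
  "p = (\<Sum>k\<in>Poly_Mapping.keys p. Poly_Mapping.single k (Poly_Mapping.lookup p k))"
  by (rule poly_mapping_eqI)
     (auto simp: lookup_sum lookup_single when_def in_keys_iff if_distrib
       cong: if_cong)

lemma meval_mult [simp]: "meval (p * q) x = meval p x * meval q x"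
proof -
  let ?s = "\<lambda>r k. Poly_Mapping.single k (Poly_Mapping.lookup r k)"
  have "p * q = (\<Sum>k\<in>Poly_Mapping.keys p. ?s p k) * (\<Sum>k\<in>Poly_Mapping.keys q. ?s q k)"
    using mpoly_sum_monomials by metis
  also have "\<dots> = (\<Sum>k\<in>Poly_Mapping.keys p. \<Sum>l\<in>Poly_Mapping.keys q. ?s p k * ?s q l)"
    by (simp add: sum_product)
  finally have "meval (p * q) x = (\<Sum>k\<in>Poly_Mapping.keys p. \<Sum>l\<in>Poly_Mapping.keys q.
      (Poly_Mapping.lookup p k * mmono k x) * (Poly_Mapping.lookup q l * mmono l x))"
    by (simp add: mult_single meval_single mmono_add mult_ac)
  also have "\<dots> = meval p x * meval q x"
    by (simp add: sum_product meval_def mmono_def)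
  finally show ?thesis .
qed

lemma meval_power [simp]: "meval (p ^ n) x = meval p x ^ n"
  by (induction n) auto

lemma meval_prod [simp]: "meval (\<Prod>i\<in>I. p i) x = (\<Prod>i\<in>I. meval (p i) x)"
  by (induction I rule: infinite_finite_induct) auto

lemma meval_sum_list [simp]: "meval (sum_list ps) x = (\<Sum>p\<leftarrow>ps. meval p x)"
  by (induction ps) auto

lemma polys_deg_le_iff: "p \<in> polys_deg_le d \<longleftrightarrow> (\<forall>k\<in>Poly_Mapping.keys p. mdeg k \<le> d)"
  by (simp add: polys_deg_le_def mdeg_def)

lemma deg_le_mono: "p \<in> polys_deg_le d \<Longrightarrow> d \<le> e \<Longrightarrow> p \<in> polys_deg_le e"
  by (force simp: polys_deg_le_iff)

lemma deg_le_single: "mdeg k \<le> d \<Longrightarrow> Poly_Mapping.single k a \<in> polys_deg_le d"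
  by (auto simp: polys_deg_le_iff)

lemma deg_le_mConst [simp]: "mConst a \<in> polys_deg_le d"
  by (auto simp: mConst_def intro!: deg_le_single)

lemma deg_le_zero [simp]: "0 \<in> polys_deg_le d"
  by (simp add: polys_deg_le_iff)

lemma deg_le_one [simp]: "1 \<in> polys_deg_le d"
  by (simp add: polys_deg_le_iff)

lemma deg_le_mVar: "1 \<le> d \<Longrightarrow> mVar v \<in> polys_deg_le d"
  by (auto simp: mVar_def mdeg_single intro!: deg_le_single)

lemma deg_le_add: "p \<in> polys_deg_le d \<Longrightarrow> q \<in> polys_deg_le d \<Longrightarrow> p + q \<in> polys_deg_le d"
  using keys_add [of p q] by (auto simp: polys_deg_le_iff)

lemma deg_le_diff: "p \<in> polys_deg_le d \<Longrightarrow> q \<in> polys_deg_le d \<Longrightarrow> p - q \<in> polys_deg_le d"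
proof -
  assume *: "p \<in> polys_deg_le d" "q \<in> polys_deg_le d"
  have "- q \<in> polys_deg_le d"
    using * by (auto simp: polys_deg_le_iff in_keys_iff)
  then show ?thesis
    using deg_le_add [of p d "- q"] * by simp
qed

lemma deg_le_sum: "(\<And>i. i \<in> I \<Longrightarrow> p i \<in> polys_deg_le d) \<Longrightarrow> (\<Sum>i\<in>I. p i) \<in> polys_deg_le d"
  by (induction I rule: infinite_finite_induct) (auto intro: deg_le_add)

lemma deg_le_mult:
  assumes "p \<in> polys_deg_le d" "q \<in> polys_deg_le e"
  shows "p * q \<in> polys_deg_le (d + e)"
proof -
  have "mdeg k \<le> d + e" if k: "k \<in> Poly_Mapping.keys (p * q)" for k
  proof -
    from k keys_mult [of p q] obtain a b
      where "k = a + b" "a \<in> Poly_Mapping.keys p" "b \<in> Poly_Mapping.keys q" by blast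
    with assms show ?thesis by (auto simp: polys_deg_le_iff mdeg_add intro!: add_mono)
  qed
  then show ?thesis by (simp add: polys_deg_le_iff)
qed

lemma deg_le_mult': "p \<in> polys_deg_le a \<Longrightarrow> q \<in> polys_deg_le b \<Longrightarrow> a + b \<le> d \<Longrightarrow> p * q \<in> polys_deg_le d"
  using deg_le_mult deg_le_mono by blast

lemma deg_le_power: "p \<in> polys_deg_le d \<Longrightarrow> p ^ n \<in> polys_deg_le (n * d)"
  by (induction n) (auto intro: deg_le_mult)

lemma deg_le_power': "p \<in> polys_deg_le a \<Longrightarrow> n * a \<le> d \<Longrightarrow> p ^ n \<in> polys_deg_le d"
  using deg_le_power deg_le_mono by blast

lemma deg_le_prod:
  "(\<And>i. i \<in> I \<Longrightarrow> p i \<in> polys_deg_le (e i)) \<Longrightarrow> (\<Prod>i\<in>I. p i) \<in> polys_deg_le (\<Sum>i\<in>I. e i)"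
  by (induction I rule: infinite_finite_induct) (auto intro: deg_le_mult)

lemma ex_deg_le: "\<exists>d. p \<in> polys_deg_le d"
  by (rule exI [of _ "\<Sum>k\<in>Poly_Mapping.keys p. mdeg k"])
     (auto simp: polys_deg_le_iff intro: member_le_sum)

text \<open>
  Ring homomorphisms out of the polynomial ring are determined by the images of the variables.
  Over a target of polynomial functions this says that substituting polynomials yields a
  polynomial; \<open>\<E>\<close> plays the part of evaluation in the target.
\<close>

lemma mpoly_substitution:
  fixes \<theta> :: "'v::finite \<Rightarrow> 'a::comm_ring_1" and \<E> :: "'a \<Rightarrow> 'b \<Rightarrow> real" and \<kappa> :: "real \<Rightarrow> 'a"
  assumes add: "\<And>a b y. \<E> (a + b) y = \<E> a y + \<E> b y"
    and mult: "\<And>a b y. \<E> (a * b) y = \<E> a y * \<E> b y"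
    and const: "\<And>c y. \<E> (\<kappa> c) y = c"
  shows "\<exists>q. \<forall>y. \<E> q y = meval p (\<chi> v. \<E> (\<theta> v) y)"
proof -
  have zero: "\<E> 0 y = 0" for y
    using add [of 0 0 y] by simp
  have one: "\<E> 1 y = 1" for y
    using mult [of "\<kappa> 1" 1 y] const [of 1 y] by simp
  have sum: "\<E> (\<Sum>i\<in>I. h i) y = (\<Sum>i\<in>I. \<E> (h i) y)" for h :: "('v \<Rightarrow>\<^sub>0 nat) \<Rightarrow> 'a" and I y
    by (induction I rule: infinite_finite_induct) (auto simp: add zero)
  have prod: "\<E> (\<Prod>i\<in>I. h i) y = (\<Prod>i\<in>I. \<E> (h i) y)" for h :: "'v \<Rightarrow> 'a" and I y
    by (induction I rule: infinite_finite_induct) (auto simp: mult one)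
  have power: "\<E> (a ^ n) y = \<E> a y ^ n" for a n y
    by (induction n) (auto simp: mult one)
  show ?thesis
    by (rule exI [of _ "\<Sum>k\<in>Poly_Mapping.keys p. \<kappa> (Poly_Mapping.lookup p k)
          * (\<Prod>v\<in>UNIV. \<theta> v ^ Poly_Mapping.lookup k v)"])
       (simp add: sum mult const prod power meval_def)
qed

text \<open>Renaming of variables; the embedding of \<open>\<real>[x]\<close> into \<open>\<real>[x, \<lambda>]\<close> is a special case.\<close>

definition mrename :: "('u \<Rightarrow> 'v) \<Rightarrow> 'u::finite mpoly \<Rightarrow> 'v::finite mpoly" where
  "mrename \<phi> p = (\<Sum>k\<in>Poly_Mapping.keys p.
     mConst (Poly_Mapping.lookup p k) * (\<Prod>i\<in>UNIV. mVar (\<phi> i) ^ Poly_Mapping.lookup k i))"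

lemma meval_mrename [simp]: "meval (mrename \<phi> p) z = meval p (\<chi> i. z $ \<phi> i)"
  by (simp add: mrename_def meval_def [of p])

lemma deg_le_mrename:
  assumes "p \<in> polys_deg_le d"
  shows "mrename \<phi> p \<in> polys_deg_le d"
  unfolding mrename_def
proof (rule deg_le_sum)
  fix k assume "k \<in> Poly_Mapping.keys p"
  then have "mdeg k \<le> d" using assms by (simp add: polys_deg_le_iff)
  moreover have "(\<Prod>i\<in>UNIV. mVar (\<phi> i) ^ Poly_Mapping.lookup k i) \<in> polys_deg_le (mdeg k)"
    unfolding mdeg_def by (rule deg_le_prod) (auto intro!: deg_le_power' deg_le_mVar)
  ultimately show "mConst (Poly_Mapping.lookup p k) * (\<Prod>i\<in>UNIV. mVar (\<phi> i) ^ Poly_Mapping.lookup k i)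
      \<in> polys_deg_le d"
    by (intro deg_le_mult' [of _ 0 _ "mdeg k"]) auto
qed

lemma lift_x_eq_mrename: "lift_x p = mrename Inl p"
  by (simp add: lift_x_def mrename_def)

lemma meval_lift_x [simp]: "meval (lift_x p) z = meval p (x_part z)"
  by (simp add: lift_x_eq_mrename x_part_def)

lemma deg_le_mpderiv:
  assumes "p \<in> polys_deg_le d"
  shows "mpderiv i p \<in> polys_deg_le (d - 1)"
  unfolding mpderiv_def
proof (rule deg_le_sum)
  fix k assume k: "k \<in> Poly_Mapping.keys p"
  let ?t = "Poly_Mapping.single (k - Poly_Mapping.single i 1)
       (of_nat (Poly_Mapping.lookup k i) * Poly_Mapping.lookup p k)"
  show "?t \<in> polys_deg_le (d - 1)"
  proof (cases "Poly_Mapping.lookup k i = 0")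
    case False
    have "k - Poly_Mapping.single i 1 + Poly_Mapping.single i 1 = k"
      using False by (intro poly_mapping_eqI) (auto simp: lookup_add lookup_minus lookup_single when_def)
    then have "mdeg (k - Poly_Mapping.single i 1) + 1 = mdeg k"
      by (metis mdeg_add mdeg_single)
    then show ?thesis using assms k by (force simp: polys_deg_le_iff intro!: deg_le_single)
  qed simp
qed

lemma meval_has_derivative:
  "(meval p has_derivative (\<lambda>h. \<Sum>i\<in>UNIV. h $ i * meval (mpderiv i p) x)) (at x)"
proof -
  have mono: "(mmono k has_derivative (\<lambda>h. \<Sum>i\<in>UNIV. h $ i *
      (of_nat (Poly_Mapping.lookup k i) * mmono (k - Poly_Mapping.single i 1) x))) (at x)" for k
  proof -
    have eq: "of_nat (Poly_Mapping.lookup k i) * mmono (k - Poly_Mapping.single i 1) x =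
      of_nat (Poly_Mapping.lookup k i) * (x $ i) ^ (Poly_Mapping.lookup k i - 1) *
        (\<Prod>j\<in>UNIV - {i}. (x $ j) ^ Poly_Mapping.lookup k j)" for i
      unfolding mmono_def
      by (subst prod.remove [of _ i]) (auto simp: lookup_minus lookup_single when_def intro!: prod.cong)
    have "((\<lambda>x. \<Prod>v\<in>UNIV. (x $ v) ^ Poly_Mapping.lookup k v) has_derivative
        (\<lambda>h. \<Sum>i\<in>UNIV. (of_nat (Poly_Mapping.lookup k i) * (h $ i) * (x $ i) ^ (Poly_Mapping.lookup k i - 1))
          * (\<Prod>j\<in>UNIV - {i}. (x $ j) ^ Poly_Mapping.lookup k j))) (at x)"
      by (intro has_derivative_prod has_derivative_power bounded_linear_imp_has_derivative
          bounded_linear_vec_nth) 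
    then show ?thesis
      unfolding eq by (simp add: mmono_def [abs_def] mult_ac)
  qed
  have "((\<lambda>x. \<Sum>k\<in>Poly_Mapping.keys p. Poly_Mapping.lookup p k * mmono k x) has_derivative
     (\<lambda>h. \<Sum>k\<in>Poly_Mapping.keys p. Poly_Mapping.lookup p k * (\<Sum>i\<in>UNIV. h $ i *
      (of_nat (Poly_Mapping.lookup k i) * mmono (k - Poly_Mapping.single i 1) x)))) (at x)"
    by (intro has_derivative_sum has_derivative_mult_right mono)
  moreover have "(\<Sum>k\<in>Poly_Mapping.keys p. Poly_Mapping.lookup p k * (\<Sum>i\<in>UNIV. h $ i *
      (of_nat (Poly_Mapping.lookup k i) * mmono (k - Poly_Mapping.single i 1) x)))
    = (\<Sum>i\<in>UNIV. h $ i * meval (mpderiv i p) x)" for h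
    unfolding mpderiv_def
    by (subst sum_distrib_left, subst sum.swap) (simp add: meval_single sum_distrib_left mult_ac)
  moreover have "meval p = (\<lambda>x. \<Sum>k\<in>Poly_Mapping.keys p. Poly_Mapping.lookup p k * mmono k x)"
    by (rule ext) (simp add: meval_def mmono_def)
  ultimately show ?thesis by simp
qed

lemma continuous_on_meval [continuous_intros]: "continuous_on S (meval p)"
  by (meson continuous_at_imp_continuous_on has_derivative_continuous meval_has_derivative)

lemma meval_derivative_unique:
  assumes "(meval p has_derivative D) (at x)"
  shows "meval (mpderiv i p) x = D (axis i 1)"
proof -
  have "D = (\<lambda>h. \<Sum>i\<in>UNIV. h $ i * meval (mpderiv i p) x)"
    using assms meval_has_derivative has_derivative_unique by blast
  then have "D (axis i 1) = (\<Sum>j\<in>UNIV. if j = i then meval (mpderiv j p) x else 0)"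
    by (simp only:, intro sum.cong refl) (simp add: axis_def)
  then show ?thesis by simp
qed

section \<open>Algebraic dependence by counting monomials\<close>

lemma underdetermined_system:
  fixes M :: "'i \<Rightarrow> 'j \<Rightarrow> real"
  assumes "finite I" "finite J" "card I < card J"
  shows "\<exists>c. (\<exists>j\<in>J. c j \<noteq> 0) \<and> (\<forall>i\<in>I. (\<Sum>j\<in>J. c j * M i j) = 0)"
  using assms
proof (induction I arbitrary: J M rule: finite_induct)
  case empty
  then have "J \<noteq> {}" by auto
  then show ?case by (intro exI [of _ "\<lambda>_. 1"]) auto
next
  case (insert i I)
  show ?case
  proof (cases "\<forall>j\<in>J. M i j = 0")
    case True
    have "card I < card J" using insert by simp
    then obtain c where "\<exists>j\<in>J. c j \<noteq> 0" "\<forall>k\<in>I. (\<Sum>j\<in>J. c j * M k j) = 0"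
      using insert.IH [OF insert.prems(1), of M] by blast
    then show ?thesis using True by (intro exI [of _ c]) auto
  next
    case False
    then obtain l where l: "l \<in> J" "M i l \<noteq> 0" by auto
    let ?J = "J - {l}"
    let ?M = "\<lambda>k j. M k j - M k l * M i j / M i l"
    have "card I < card ?J" using insert l by simp
    then obtain c where c: "\<exists>j\<in>?J. c j \<noteq> 0" "\<forall>k\<in>I. (\<Sum>j\<in>?J. c j * ?M k j) = 0"
      using insert.IH [of ?J ?M] insert.prems(1) by blast
    define c' where "c' = c(l := - (\<Sum>j\<in>?J. c j * M i j) / M i l)"
    have split: "(\<Sum>j\<in>J. c' j * M k j)
        = (\<Sum>j\<in>?J. c j * M k j) - (\<Sum>j\<in>?J. c j * M i j) / M i l * M k l" for k
    proof -
      have "(\<Sum>j\<in>J. c' j * M k j) = c' l * M k l + (\<Sum>j\<in>?J. c' j * M k j)"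
        using l insert by (simp add: sum.remove)
      also have "(\<Sum>j\<in>?J. c' j * M k j) = (\<Sum>j\<in>?J. c j * M k j)"
        by (intro sum.cong) (auto simp: c'_def)
      finally show ?thesis by (simp add: c'_def)
    qed
    have "(\<Sum>j\<in>J. c' j * M k j) = 0" if "k \<in> insert i I" for k
    proof (cases "k = i")
      case True
      then show ?thesis using l by (simp add: split)
    next
      case False
      then have "(\<Sum>j\<in>?J. c j * ?M k j) = 0" using that c by auto
      also have "(\<Sum>j\<in>?J. c j * ?M k j)
          = (\<Sum>j\<in>?J. c j * M k j) - (\<Sum>j\<in>?J. c j * M i j) / M i l * M k l"
        by (simp add: right_diff_distrib sum_subtractf sum_distrib_left sum_divide_distrib mult_ac)
      finally show ?thesis by (simp add: split)
    qed
    moreover have "\<exists>j\<in>J. c' j \<noteq> 0" using c(1) by (auto simp: c'_def)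
    ultimately show ?thesis by blast
  qed
qed

text \<open>
  Induction on the number of variables: with the other variables fixed, the sum is a polynomial in
  one variable with infinitely many roots.
\<close>

lemma coefficients_zero_if_vanishing:
  fixes X :: "'w \<Rightarrow> real set"
  assumes "finite I" "finite A" "\<forall>a\<in>A. Poly_Mapping.keys a \<subseteq> I" "\<And>i. infinite (X i)"
    and "\<And>t. (\<And>i. i \<in> I \<Longrightarrow> t i \<in> X i)
      \<Longrightarrow> (\<Sum>a\<in>A. c a * (\<Prod>i\<in>I. t i ^ Poly_Mapping.lookup a i)) = 0"
  shows "\<forall>a\<in>A. c a = 0"
  using assms(1,2,3,5)
proof (induction I arbitrary: A c rule: finite_induct)
  case empty
  then have "A \<subseteq> {0}" by auto
  then show ?case using empty by (cases "A = {}") (auto simp: subset_singleton_iff)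
next
  case (insert i I)
  have "c a = 0" if a: "a \<in> A" for a
  proof -
    define m where "m = Poly_Mapping.lookup a i"
    define Am where "Am = {a\<in>A. Poly_Mapping.lookup a i = m}"
    define r where "r = (\<lambda>a::'w \<Rightarrow>\<^sub>0 nat. a - Poly_Mapping.single i m)"
    have r: "r b + Poly_Mapping.single i m = b" if "b \<in> Am" for b
      using that by (intro poly_mapping_eqI)
        (auto simp: r_def Am_def lookup_add lookup_minus lookup_single when_def)
    have inj: "inj_on r Am" by (rule inj_onI) (metis r)
    have look: "Poly_Mapping.lookup (r b) k = Poly_Mapping.lookup b k" if "k \<in> I" for b k
      using that insert(2) by (auto simp: r_def lookup_minus lookup_single when_def)
    have "\<forall>b\<in>r ` Am. c (b + Poly_Mapping.single i m) = 0"
    proof (rule insert.IH)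
      show "finite (r ` Am)" using insert.prems by (simp add: Am_def)
      show "\<forall>b\<in>r ` Am. Poly_Mapping.keys b \<subseteq> I"
      proof safe
        fix b k assume b: "b \<in> Am" and k: "k \<in> Poly_Mapping.keys (r b)"
        have "k \<noteq> i" using b k by (auto simp: r_def Am_def in_keys_iff lookup_minus)
        moreover have "k \<in> Poly_Mapping.keys b"
          using k by (auto simp: r_def in_keys_iff lookup_minus)
        ultimately show "k \<in> I" using b insert.prems(2) by (auto simp: Am_def)
      qed
      fix t assume t: "\<And>k. k \<in> I \<Longrightarrow> t k \<in> X k"
      define u where "u = (\<lambda>b. c b * (\<Prod>k\<in>I. t k ^ Poly_Mapping.lookup b k))"
      define q where "q = (\<Sum>b\<in>A. monom (u b) (Poly_Mapping.lookup b i))"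
      have "poly q s = 0" if "s \<in> X i" for s
      proof -
        have "0 = (\<Sum>b\<in>A. c b * (\<Prod>k\<in>insert i I. (t(i := s)) k ^ Poly_Mapping.lookup b k))"
          using t that by (intro insert.prems(3) [symmetric]) auto
        also have "\<dots> = (\<Sum>b\<in>A. u b * s ^ Poly_Mapping.lookup b i)"
        proof (intro sum.cong refl)
          fix b
          have "(\<Prod>k\<in>I. (t(i := s)) k ^ Poly_Mapping.lookup b k)
              = (\<Prod>k\<in>I. t k ^ Poly_Mapping.lookup b k)"
            using insert(2) by (intro prod.cong) auto
          then show "c b * (\<Prod>k\<in>insert i I. (t(i := s)) k ^ Poly_Mapping.lookup b k)
              = u b * s ^ Poly_Mapping.lookup b i"
            using insert(1,2) by (simp add: u_def)
        qed
        also have "\<dots> = poly q s"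
          by (simp add: q_def poly_sum poly_monom)
        finally show ?thesis by simp
      qed
      then have "q = 0"
        using assms(4)[of i] finite_subset [OF subsetI poly_roots_finite [of q], of "X i"] by auto
      then have "0 = coeff q m" by simp
      also have "\<dots> = (\<Sum>b\<in>A. if Poly_Mapping.lookup b i = m then u b else 0)"
        by (simp add: q_def coeff_sum)
      also have "\<dots> = (\<Sum>b\<in>Am. u b)"
        using insert.prems(1) by (simp add: Am_def sum.inter_filter)
      also have "\<dots> = (\<Sum>b\<in>r ` Am. c (b + Poly_Mapping.single i m)
          * (\<Prod>k\<in>I. t k ^ Poly_Mapping.lookup b k))"
        by (simp add: sum.reindex [OF inj] r look u_def)
      finally show "(\<Sum>b\<in>r ` Am. c (b + Poly_Mapping.single i m)
          * (\<Prod>k\<in>I. t k ^ Poly_Mapping.lookup b k)) = 0" by simp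
    qed
    moreover have "a \<in> Am" using a by (simp add: Am_def m_def)
    ultimately show ?thesis using r by force
  qed
  then show ?case by blast
qed

lemma nonzero_mpoly_nonvanishing:
  fixes p :: "'w::finite mpoly"
  assumes "p \<noteq> 0" "\<And>i. infinite (X i)"
  obtains t where "\<And>i. t $ i \<in> X i" "meval p t \<noteq> 0"
proof -
  have "\<exists>t. (\<forall>i. t $ i \<in> X i) \<and> meval p t \<noteq> 0"
  proof (rule ccontr)
    assume *: "\<not> ?thesis"
    have "\<forall>k\<in>Poly_Mapping.keys p. Poly_Mapping.lookup p k = 0"
    proof (rule coefficients_zero_if_vanishing [where I = UNIV and X = X])
      fix t :: "'w \<Rightarrow> real" assume "\<And>i. i \<in> UNIV \<Longrightarrow> t i \<in> X i"
      then have "\<forall>i. (\<chi> i. t i) $ i \<in> X i" by simp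
      then have "meval p (\<chi> i. t i) = 0" using * by blast
      then show "(\<Sum>a\<in>Poly_Mapping.keys p. Poly_Mapping.lookup p a
          * (\<Prod>i\<in>UNIV. t i ^ Poly_Mapping.lookup a i)) = 0"
        by (simp add: meval_def)
    qed (use assms in auto)
    then have "p = 0" by (intro poly_mapping_eqI) (auto simp: in_keys_iff)
    with \<open>p \<noteq> 0\<close> show False by simp
  qed
  then obtain t where "\<forall>i. t $ i \<in> X i" "meval p t \<noteq> 0" by blast
  then show thesis using that [of t] by simp
qed

definition expvecs :: "nat \<Rightarrow> ('w::finite \<Rightarrow>\<^sub>0 nat) set" where
  "expvecs D = {a. mdeg a \<le> D}"

lemma finite_card_expvecs:
  "finite (expvecs D :: ('w::finite \<Rightarrow>\<^sub>0 nat) set) \<and>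
   card (expvecs D :: ('w::finite \<Rightarrow>\<^sub>0 nat) set) \<le> (D + 1) ^ CARD('w)"
proof -
  let ?E = "expvecs D :: ('w \<Rightarrow>\<^sub>0 nat) set"
  let ?T = "PiE (UNIV :: 'w set) (\<lambda>_. {..D})"
  have inj: "inj_on Poly_Mapping.lookup ?E"
    by (rule inj_onI) (simp only: poly_mapping_eq_iff)
  have sub: "Poly_Mapping.lookup ` ?E \<subseteq> ?T"
  proof
    fix h assume "h \<in> Poly_Mapping.lookup ` ?E"
    then obtain a :: "'w \<Rightarrow>\<^sub>0 nat" where a: "h = Poly_Mapping.lookup a" "mdeg a \<le> D"
      by (auto simp: expvecs_def)
    have "h i \<le> mdeg a" for i
      unfolding a mdeg_def by (intro member_le_sum) auto
    then have "h i \<le> D" for i using a(2) order_trans by blast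
    then show "h \<in> ?T" by (simp add: PiE_iff)
  qed
  have T: "finite ?T" by (simp add: finite_PiE)
  have "finite ?E" by (rule finite_imageD [OF finite_subset [OF sub T] inj])
  moreover have "card ?E \<le> card ?T"
    using card_mono [OF T sub] card_image [OF inj] by simp
  ultimately show ?thesis by (simp add: card_PiE)
qed

text \<open>
  A sequence of polynomial growth of order \<open>N\<close> cannot gain more than a factor \<open>e\<^sup>N\<close> at each of
  the steps \<open>A \<mapsto> A e + c\<close>, since iterating them makes \<open>A\<close> grow only like \<open>e\<^sup>j\<close>.
\<close>

lemma polynomial_growth_step:
  fixes s :: "nat \<Rightarrow> nat"
  assumes bound: "\<And>D. s D \<le> (D + 1) ^ N" and pos: "s 0 \<ge> 1" and e: "e \<ge> 2"
  shows "\<exists>A. s (A * e + c) < (e ^ N + 1) * s A"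
proof (rule ccontr)
  assume "\<not> ?thesis"
  then have *: "(e ^ N + 1) * s A \<le> s (A * e + c)" for A by (auto simp: not_less)
  define A where "A = rec_nat 0 (\<lambda>_ a. a * e + c)"
  have A: "A 0 = 0" "A (Suc j) = A j * e + c" for j by (simp_all add: A_def)
  have lower: "(e ^ N + 1) ^ j \<le> s (A j)" for j
  proof (induction j)
    case (Suc j)
    have "(e ^ N + 1) ^ Suc j \<le> (e ^ N + 1) * s (A j)"
      unfolding power_Suc using Suc by (rule mult_le_mono2)
    also have "\<dots> \<le> s (A (Suc j))" using * A by simp
    finally show ?case .
  qed (use pos A in simp)
  \<comment> \<open>The shift by \<open>c + 1\<close> absorbs the additive constant of the recursion.\<close>
  have upper: "A j + (c + 1) \<le> e ^ j * (c + 1)" for j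
  proof (induction j)
    case (Suc j)
    have "c + (c + 1) \<le> 2 * (c + 1)" by simp
    also have "\<dots> \<le> e * (c + 1)" using e by (rule mult_le_mono1)
    finally have "A (Suc j) + (c + 1) \<le> e * (A j + (c + 1))"
      by (simp add: A algebra_simps)
    also have "\<dots> \<le> e * (e ^ j * (c + 1))" using Suc by (rule mult_le_mono2)
    finally show ?case by (simp add: mult_ac)
  qed (simp add: A)
  have main: "(e ^ N + 1) ^ j \<le> (e ^ N) ^ j * (c + 1) ^ N" for j
  proof -
    have "(e ^ N + 1) ^ j \<le> (A j + 1) ^ N" using lower bound order_trans by blast
    also have "\<dots> \<le> (e ^ j * (c + 1)) ^ N" using upper [of j] by (intro power_mono) auto
    also have "\<dots> = (e ^ N) ^ j * (c + 1) ^ N"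
      by (simp only: power_mult_distrib power_mult [symmetric] mult.commute [of j N])
    finally show ?thesis .
  qed
  define x where "x = (real e ^ N + 1) / real e ^ N"
  have x: "x > 1" using e by (simp add: x_def field_simps)
  have "x ^ j \<le> (real c + 1) ^ N" for j
  proof -
    have "real ((e ^ N + 1) ^ j) \<le> real ((e ^ N) ^ j * (c + 1) ^ N)"
      using main of_nat_mono by blast
    then have "(real e ^ N + 1) ^ j \<le> (real e ^ N) ^ j * (real c + 1) ^ N"
      by (simp add: add.commute)
    then show ?thesis using e by (simp add: x_def power_divide divide_le_eq mult.commute)
  qed
  then show False using real_arch_pow [OF x] by (meson not_less)
qed

text \<open>
  The products \<open>F\<^sup>a f\<^sup>b\<close> with \<open>|a| \<le> A\<close> and \<open>b \<le> e\<^sup>N\<close> lie in the space of polynomials of degree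
  at most \<open>A e + d e\<^sup>N\<close>, whose dimension grows like \<open>e\<^sup>N A\<^sup>N / N!\<close>. There are about
  \<open>(e\<^sup>N + 1) A\<^sup>N / N!\<close> of them, so for large \<open>A\<close> they are linearly dependent. The resulting
  relation has degree at most \<open>e\<^sup>N\<close>, the Bezout number, in \<open>f\<close>.
\<close>

theorem algebraic_dependence:
  fixes F :: "'w::finite \<Rightarrow> 'w mpoly" and f :: "'w mpoly"
  assumes F: "\<And>w. F w \<in> polys_deg_le e" and e: "e \<ge> 2"
  obtains p :: "nat \<Rightarrow> 'w mpoly" and b
  where "b \<le> e ^ CARD('w)" "p b \<noteq> 0"
    "\<And>z. (\<Sum>b\<le>e ^ CARD('w). meval (p b) (\<chi> w. meval (F w) z) * meval f z ^ b) = 0"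
proof -
  define B where "B = e ^ CARD('w)"
  obtain d where d: "f \<in> polys_deg_le d" using ex_deg_le by blast
  define s where "s = (\<lambda>D. card (expvecs D :: ('w \<Rightarrow>\<^sub>0 nat) set))"
  have "s 0 \<ge> 1"
  proof -
    have "(0 :: 'w \<Rightarrow>\<^sub>0 nat) \<in> expvecs 0" by (simp add: expvecs_def)
    then show ?thesis unfolding s_def using finite_card_expvecs
      by (simp add: Suc_le_eq card_gt_0_iff) blast
  qed
  then obtain A where A: "s (A * e + d * B) < (B + 1) * s A"
    using polynomial_growth_step [of s "CARD('w)" e "d * B"] finite_card_expvecs e
    by (auto simp: s_def B_def)
  define D where "D = A * e + d * B"
  define I :: "('w \<Rightarrow>\<^sub>0 nat) set" where "I = expvecs D"
  define S :: "('w \<Rightarrow>\<^sub>0 nat) set" where "S = expvecs A"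
  define P where "P = (\<lambda>a b. (\<Prod>w\<in>UNIV. F w ^ Poly_Mapping.lookup a w) * f ^ b)"
  have fin: "finite I" "finite S" using finite_card_expvecs by (auto simp: I_def S_def)
  have "card I < card (S \<times> {..B})"
    using A by (simp add: card_cartesian_product I_def S_def s_def D_def mult.commute)
  then obtain c where c: "\<exists>j\<in>S \<times> {..B}. c j \<noteq> 0"
    "\<forall>k\<in>I. (\<Sum>j\<in>S \<times> {..B}. c j * Poly_Mapping.lookup (P (fst j) (snd j)) k) = 0"
    using underdetermined_system [of I "S \<times> {..B}" "\<lambda>k j. Poly_Mapping.lookup (P (fst j) (snd j)) k"]
      fin by auto
  have degP: "Poly_Mapping.keys (P a b) \<subseteq> I" if "a \<in> S" "b \<le> B" for a b
  proof -
    have "(\<Prod>w\<in>UNIV. F w ^ Poly_Mapping.lookup a w)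
        \<in> polys_deg_le (\<Sum>w\<in>UNIV. Poly_Mapping.lookup a w * e)"
      by (intro deg_le_prod deg_le_power F)
    moreover have "(\<Sum>w\<in>UNIV. Poly_Mapping.lookup a w * e) \<le> A * e"
      using that(1) by (simp add: S_def expvecs_def mdeg_def sum_distrib_right [symmetric])
    moreover have "f ^ b \<in> polys_deg_le (d * B)"
      using d that(2) by (intro deg_le_power' [of _ d]) (auto simp: mult.commute)
    ultimately have "P a b \<in> polys_deg_le D"
      unfolding P_def D_def by (intro deg_le_mult' [of _ "\<Sum>w\<in>UNIV. Poly_Mapping.lookup a w * e"]) auto
    then show ?thesis by (auto simp: polys_deg_le_iff I_def expvecs_def)
  qed
  define p where "p = (\<lambda>b. \<Sum>a\<in>S. Poly_Mapping.single a (c (a, b)))"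
  have look: "Poly_Mapping.lookup (p b) a = c (a, b)" if "a \<in> S" for a b
    using that fin by (simp add: p_def lookup_sum lookup_single when_def)
  have rel: "(\<Sum>b\<le>B. meval (p b) (\<chi> w. meval (F w) z) * meval f z ^ b) = 0" for z
  proof -
    have ev: "meval (P a b) z = (\<Sum>k\<in>I. Poly_Mapping.lookup (P a b) k * mmono k z)"
      if "a \<in> S" "b \<le> B" for a b
      using degP [OF that] fin by (intro meval_superset)
    have "(\<Sum>b\<le>B. meval (p b) (\<chi> w. meval (F w) z) * meval f z ^ b)
        = (\<Sum>b\<le>B. \<Sum>a\<in>S. c (a, b) * meval (P a b) z)"
      by (simp add: p_def P_def meval_single mmono_def sum_distrib_left sum_distrib_right mult_ac)
    also have "\<dots> = (\<Sum>a\<in>S. \<Sum>b\<le>B. c (a, b) * meval (P a b) z)"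
      by (rule sum.swap)
    also have "\<dots> = (\<Sum>j\<in>S \<times> {..B}. c j * meval (P (fst j) (snd j)) z)"
      by (simp add: sum.cartesian_product split_def)
    also have "\<dots> = (\<Sum>j\<in>S \<times> {..B}. \<Sum>k\<in>I.
        c j * (Poly_Mapping.lookup (P (fst j) (snd j)) k * mmono k z))"
      by (intro sum.cong refl) (auto simp: ev sum_distrib_left)
    also have "\<dots> = (\<Sum>k\<in>I. \<Sum>j\<in>S \<times> {..B}.
        c j * (Poly_Mapping.lookup (P (fst j) (snd j)) k * mmono k z))"
      by (rule sum.swap)
    also have "\<dots> = (\<Sum>k\<in>I. (\<Sum>j\<in>S \<times> {..B}.
        c j * Poly_Mapping.lookup (P (fst j) (snd j)) k) * mmono k z)"
      by (simp add: sum_distrib_right mult.assoc)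
    also have "\<dots> = 0" using c(2) by simp
    finally show ?thesis .
  qed
  from c(1) obtain a b where ab: "a \<in> S" "b \<le> B" "c (a, b) \<noteq> 0" by auto
  then have "p b \<noteq> 0" using look [of a b] by auto
  then show thesis by (rule that [OF ab(2) [unfolded B_def] _ rel [unfolded B_def]])
qed

text \<open>
  A Bezout inequality that counts values over a box instead of points of one fibre: if
  polynomials \<open>F\<^sub>w\<close>, as many as there are variables, attain every \<open>t\<close> of a box at points where
  \<open>f\<close> has the same number of different values, then the relation between \<open>F\<close> and \<open>f\<close>, of degree
  at most \<open>e\<^sup>N\<close> in \<open>f\<close>, has that many roots for every \<open>t\<close> of the box, and for some \<open>t\<close> it is not
  the zero polynomial.
\<close>

corollary values_on_fibres_bound:
  fixes F :: "'w::finite \<Rightarrow> 'w mpoly" and f :: "'w mpoly" and A :: "'a set"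
  assumes F: "\<And>w. F w \<in> polys_deg_le e" and e: "e \<ge> 2" and X: "\<And>w. infinite (X w)"
    and fibre: "\<And>t. (\<And>w. t $ w \<in> X w) \<Longrightarrow>
      \<exists>r. inj_on r A \<and> (\<forall>a\<in>A. \<exists>z. (\<forall>w. meval (F w) z = t $ w) \<and> meval f z = r a)"
    and "finite A"
  shows "card A \<le> e ^ CARD('w)"
proof -
  define B where "B = e ^ CARD('w)"
  obtain p :: "nat \<Rightarrow> 'w mpoly" and b where p: "b \<le> B" "p b \<noteq> 0"
    and rel: "\<And>z. (\<Sum>b\<le>B. meval (p b) (\<chi> w. meval (F w) z) * meval f z ^ b) = 0"
    by (rule algebraic_dependence [OF F e, where f = f, folded B_def]) (rule that)
  obtain t where t: "\<And>w. t $ w \<in> X w" "meval (p b) t \<noteq> 0"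
    by (rule nonzero_mpoly_nonvanishing [OF p(2) X]) (rule that)
  obtain r where r: "inj_on r A"
    "\<And>a. a \<in> A \<Longrightarrow> \<exists>z. (\<forall>w. meval (F w) z = t $ w) \<and> meval f z = r a"
    using fibre [OF t(1)] by blast
  define q where "q = (\<Sum>b\<le>B. monom (meval (p b) t) b)"
  have "coeff q b = meval (p b) t" using p(1) by (simp add: q_def coeff_sum)
  then have "q \<noteq> 0" using t(2) by auto
  have root: "poly q (r a) = 0" if a: "a \<in> A" for a
  proof -
    from r(2) [OF a] obtain z where z: "\<forall>w. meval (F w) z = t $ w" "meval f z = r a" by blast
    have "(\<chi> w. meval (F w) z) = t" using z(1) by (simp add: vec_eq_iff)
    then show ?thesis using rel [of z] z(2) by (simp add: q_def poly_sum poly_monom)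
  qed
  have "card A = card (r ` A)" using r(1) by (simp add: card_image)
  also have "\<dots> \<le> card {x. poly q x = 0}"
    using root by (intro card_mono poly_roots_finite \<open>q \<noteq> 0\<close>) auto
  also have "\<dots> \<le> degree q" by (rule card_poly_roots_bound [OF \<open>q \<noteq> 0\<close>])
  also have "\<dots> \<le> B"
    unfolding q_def by (rule degree_sum_le) (auto intro: order_trans [OF degree_monom_le])
  finally show ?thesis by (simp add: B_def)
qed

section \<open>The number of values of a polynomial on a real algebraic set\<close>

lemma compact_positive_lower_bound:
  fixes h :: "'a::metric_space \<Rightarrow> real"
  assumes "compact K" "continuous_on K h" "\<And>z. z \<in> K \<Longrightarrow> h z > 0"
  obtains c where "c > 0" "\<And>z. z \<in> K \<Longrightarrow> h z \<ge> c"
proof (cases "K = {}")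
  case False
  then obtain u where "u \<in> K" "\<And>z. z \<in> K \<Longrightarrow> h u \<le> h z"
    using continuous_attains_inf [OF assms(1) _ assms(2)] by blast
  then show thesis using that [of "h u"] assms(3) by blast
qed (use that [of 1] in auto)

lemma finite_reals_separated:
  fixes A :: "real set"
  assumes "finite A"
  obtains \<delta> where "\<delta> > 0" "\<And>a b. a \<in> A \<Longrightarrow> b \<in> A \<Longrightarrow> a \<noteq> b \<Longrightarrow> \<delta> \<le> \<bar>a - b\<bar>"
proof -
  let ?D = "insert 1 ((\<lambda>(a, b). \<bar>a - b\<bar>) ` (A \<times> A) - {0})"
  have fin: "finite ?D" using assms by simp
  show thesis
  proof (rule that [of "Min ?D"])
    show "Min ?D > 0" using fin by (subst Min_gr_iff) auto
    show "Min ?D \<le> \<bar>a - b\<bar>" if "a \<in> A" "b \<in> A" "a \<noteq> b" for a b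
      using that fin by (intro Min_le) auto
  qed
qed

lemma power2_norm_vec: "(norm (z :: real ^ 'v::finite))\<^sup>2 = (\<Sum>i\<in>UNIV. (z $ i)\<^sup>2)"
  unfolding power2_norm_eq_inner inner_vec_def by (simp add: power2_eq_square)

text \<open>
  Milnor's argument for counting components, with values in place of components. Countability of
  the set of values provides a \<open>\<delta>\<close> for which no \<open>a \<plusminus> \<delta>\<close> is a value, so \<open>G > 0\<close> where
  \<open>|f - a| = \<delta>\<close>. For large \<open>M\<close> the function \<open>M G + |z|\<^sup>2\<close> is therefore at least \<open>R\<^sup>2\<close> on
  the boundary of \<open>{|z| \<le> R, |f - a| \<le> \<delta>}\<close>, but smaller at some point inside. This survives
  subtracting \<open>t \<bullet> z\<close> for small \<open>t\<close>, hence the gradient of \<open>M G + |z|\<^sup>2\<close> attains every small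
  \<open>t\<close> at points where \<open>f\<close> is close to \<open>a\<close>, for each of the values \<open>a\<close>.
\<close>

theorem values_on_zero_set_bound:
  fixes G f :: "'v::finite mpoly"
  assumes G: "G \<in> polys_deg_le (e + 1)" and e: "e \<ge> 2" and nonneg: "\<And>z. meval G z \<ge> 0"
    and count: "countable (meval f ` {z. meval G z = 0})"
    and A: "A \<subseteq> meval f ` {z. meval G z = 0}" "finite A"
  shows "card A \<le> e ^ CARD('v)"
proof -
  have "\<forall>a\<in>A. \<exists>z. meval G z = 0 \<and> meval f z = a" using A(1) by force
  then obtain y where y: "\<And>a. a \<in> A \<Longrightarrow> meval G (y a) = 0" "\<And>a. a \<in> A \<Longrightarrow> meval f (y a) = a"
    by metis
  \<comment> \<open>The margin \<open>1\<close> leaves room for the linear perturbation, which is at most \<open>R / 4\<close>.\<close>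
  define R where "R = (\<Sum>a\<in>A. norm (y a)) + 1"
  have R: "R \<ge> 1" by (simp add: R_def sum_nonneg)
  have yR: "norm (y a) \<le> R - 1" if "a \<in> A" for a
    unfolding R_def using that A(2) member_le_sum [of a A "\<lambda>a. norm (y a)"] by simp
  obtain \<delta>0 where \<delta>0: "\<delta>0 > 0" "\<And>a b. a \<in> A \<Longrightarrow> b \<in> A \<Longrightarrow> a \<noteq> b \<Longrightarrow> \<delta>0 \<le> \<bar>a - b\<bar>"
    using finite_reals_separated [OF A(2)] by blast
  define bad where "bad = (\<Union>a\<in>A. (\<lambda>v. v - a) ` meval f ` {z. meval G z = 0}
      \<union> (\<lambda>v. a - v) ` meval f ` {z. meval G z = 0})"
  have "countable bad"
    unfolding bad_def using A(2) count by (intro countable_UN countable_Un) (auto intro: countable_finite)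
  then have "{0<..<\<delta>0 / 2} - bad \<noteq> {}"
    using uncountable_open_interval [of 0 "\<delta>0 / 2"] \<delta>0(1)
    by (metis Diff_eq_empty_iff countable_subset half_gt_zero)
  then obtain \<delta> where "\<delta> \<in> {0<..<\<delta>0 / 2} - bad" by blast
  then have \<delta>: "0 < \<delta>" "\<delta> < \<delta>0 / 2" "\<delta> \<notin> bad" by auto
  have pos: "meval G z > 0" if "a \<in> A" "\<bar>meval f z - a\<bar> = \<delta>" for a z
  proof (rule ccontr)
    assume "\<not> ?thesis"
    then have z: "meval G z = 0" using nonneg [of z] by simp
    have "meval f z - a = \<delta> \<or> a - meval f z = \<delta>" using that(2) by linarith
    then have "\<delta> \<in> bad" unfolding bad_def using that(1) z by blast
    with \<delta>(3) show False by simp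
  qed
  define K where "K = (\<Union>a\<in>A. cball 0 R \<inter> {z. \<bar>meval f z - a\<bar> = \<delta>})"
  have "compact (cball 0 R \<inter> {z. \<bar>meval f z - a\<bar> = \<delta>})" for a
  proof -
    have "closed {z. \<bar>meval f z - a\<bar> = \<delta>}"
      by (intro closed_Collect_eq continuous_intros)
    then show ?thesis by (intro compact_Int_closed compact_cball)
  qed
  then have "compact K" unfolding K_def using A(2) by (intro compact_UN) auto
  moreover have "\<And>z. z \<in> K \<Longrightarrow> meval G z > 0" using pos by (auto simp: K_def)
  ultimately obtain c where c: "c > 0" "\<And>z. z \<in> K \<Longrightarrow> meval G z \<ge> c"
    using compact_positive_lower_bound [of K "meval G"] continuous_on_meval by blast
  define M where "M = R\<^sup>2 / c"
  have M: "M \<ge> 0" "M * c = R\<^sup>2" using c(1) by (auto simp: M_def)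
  define \<Psi> where "\<Psi> = mConst M * G + (\<Sum>i\<in>UNIV. mVar i ^ 2)"
  have ev: "meval \<Psi> z = M * meval G z + (norm z)\<^sup>2" for z
    by (simp add: \<Psi>_def power2_norm_vec)
  have "\<Psi> \<in> polys_deg_le (e + 1)"
    unfolding \<Psi>_def using e G
    by (intro deg_le_add deg_le_sum deg_le_mult' [of _ 0 _ "e + 1"] deg_le_power' [of _ 1] deg_le_mVar) auto
  then have deg: "mpderiv w \<Psi> \<in> polys_deg_le e" for w
    using deg_le_mpderiv [of \<Psi> "e + 1" w] by simp
  define N where "N = real CARD('v)"
  have N: "N > 0" by (simp add: N_def)
  have critical: "\<exists>z. (\<forall>w. meval (mpderiv w \<Psi>) z = t $ w) \<and> \<bar>meval f z - a\<bar> < \<delta>"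
    if a: "a \<in> A" and t: "norm t \<le> 1 / 4" for a t
  proof -
    define h where "h = (\<lambda>z. meval \<Psi> z - t \<bullet> z)"
    define U where "U = cball 0 R \<inter> {z. \<bar>meval f z - a\<bar> \<le> \<delta>}"
    have "closed {z. \<bar>meval f z - a\<bar> \<le> \<delta>}" by (intro closed_Collect_le continuous_intros)
    then have "compact U" unfolding U_def by (intro compact_Int_closed compact_cball)
    moreover have yU: "y a \<in> U" using yR [OF a] y [OF a] \<delta>(1) by (simp add: U_def)
    moreover have "continuous_on U h" unfolding h_def by (intro continuous_intros)
    ultimately obtain z where z: "z \<in> U" "\<And>u. u \<in> U \<Longrightarrow> h z \<le> h u"
      using continuous_attains_inf [of U h] by blast
    have tR: "\<bar>t \<bullet> u\<bar> \<le> R / 4" if "norm u \<le> R" for u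
    proof -
      have "\<bar>t \<bullet> u\<bar> \<le> norm t * norm u" by (rule Cauchy_Schwarz_ineq2)
      also have "\<dots> \<le> 1 / 4 * R" using t that by (intro mult_mono) auto
      finally show ?thesis by simp
    qed
    have "h (y a) \<le> (norm (y a))\<^sup>2 + R / 4"
      using tR [of "y a"] yR [OF a] y(1) [OF a] by (simp add: h_def ev)
    also have "(norm (y a))\<^sup>2 \<le> (R - 1)\<^sup>2" using yR [OF a] by (intro power_mono) auto
    finally have "h z < R\<^sup>2 - R / 4"
      using z(2) [OF yU] R by (simp add: power2_eq_square algebra_simps)
    moreover have zR: "norm z \<le> R" using z(1) by (simp add: U_def)
    ultimately have small: "meval \<Psi> z < R\<^sup>2" using tR [of z] by (simp add: h_def)
    have "norm z \<noteq> R" using small mult_nonneg_nonneg [OF M(1) nonneg [of z]] by (auto simp: ev)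
    then have "norm z < R" using zR by simp
    moreover have "\<bar>meval f z - a\<bar> \<noteq> \<delta>"
    proof
      assume "\<bar>meval f z - a\<bar> = \<delta>"
      then have "z \<in> K" using a zR by (auto simp: K_def)
      then have "M * c \<le> M * meval G z" using c(2) M(1) by (intro mult_left_mono) auto
      then have "R\<^sup>2 \<le> meval \<Psi> z" unfolding ev M(2) by (intro add_increasing2) auto
      then show False using small by simp
    qed
    then have close: "\<bar>meval f z - a\<bar> < \<delta>" using z(1) by (simp add: U_def)
    ultimately have zO: "z \<in> ball 0 R \<inter> {z. \<bar>meval f z - a\<bar> < \<delta>}" by simp
    have "open {z. \<bar>meval f z - a\<bar> < \<delta>}" by (intro open_Collect_less continuous_intros)
    then have op: "open (ball 0 R \<inter> {z. \<bar>meval f z - a\<bar> < \<delta>})" by (intro open_Int open_ball)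
    have der: "(h has_derivative (\<lambda>v. (\<Sum>i\<in>UNIV. v $ i * meval (mpderiv i \<Psi>) z) - t \<bullet> v)) (at z)"
      unfolding h_def by (intro derivative_intros meval_has_derivative)
    have "(\<lambda>v. (\<Sum>i\<in>UNIV. v $ i * meval (mpderiv i \<Psi>) z) - t \<bullet> v) = (\<lambda>v. 0)"
      by (rule differential_zero_maxmin [OF zO op der])
         (use z(2) in \<open>auto simp: U_def less_imp_le\<close>)
    then have "(\<Sum>i\<in>UNIV. axis w 1 $ i * meval (mpderiv i \<Psi>) z) - t \<bullet> axis w 1 = 0" for w
      by (rule fun_cong)
    then have "meval (mpderiv w \<Psi>) z = t \<bullet> axis w 1" for w
      using meval_derivative_unique [OF meval_has_derivative, of w \<Psi> z]
      by (simp only: right_minus_eq)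
    then have "meval (mpderiv w \<Psi>) z = t $ w" for w
      by (simp add: inner_axis)
    with close show ?thesis by blast
  qed
  show ?thesis
  proof (rule values_on_fibres_bound [OF deg e _ _ A(2),
        where X = "\<lambda>_. {- (1 / (4 * N))..1 / (4 * N)}" and f = f])
    show "infinite {- (1 / (4 * N))..1 / (4 * N)}"
      using N by (simp add: infinite_Icc_iff)
    fix t :: "real ^ 'v" assume t: "\<And>w. t $ w \<in> {- (1 / (4 * N))..1 / (4 * N)}"
    have "norm t \<le> (\<Sum>w\<in>UNIV. \<bar>t $ w\<bar>)" by (rule norm_le_l1_cart)
    also have "\<dots> \<le> (\<Sum>w\<in>(UNIV :: 'v set). 1 / (4 * N))"
      using t by (intro sum_mono) (auto simp: abs_le_iff minus_le_iff)
    also have "\<dots> = 1 / 4" using N by (simp add: N_def)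
    finally have "\<forall>a\<in>A. \<exists>z. (\<forall>w. meval (mpderiv w \<Psi>) z = t $ w) \<and> \<bar>meval f z - a\<bar> < \<delta>"
      using critical by blast
    then obtain z where z: "\<And>a. a \<in> A \<Longrightarrow> \<forall>w. meval (mpderiv w \<Psi>) (z a) = t $ w"
      "\<And>a. a \<in> A \<Longrightarrow> \<bar>meval f (z a) - a\<bar> < \<delta>" by metis
    have "inj_on (\<lambda>a. meval f (z a)) A"
    proof (rule inj_onI, rule ccontr)
      fix a b assume ab: "a \<in> A" "b \<in> A" "meval f (z a) = meval f (z b)" "a \<noteq> b"
      then have "\<delta>0 \<le> \<bar>a - b\<bar>" using \<delta>0(2) by blast
      then show False using z(2) [OF ab(1)] z(2) [OF ab(2)] ab(3) \<delta>(2) by linarith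
    qed
    with z(1) show "\<exists>r. inj_on r A \<and> (\<forall>a\<in>A. \<exists>z. (\<forall>w. meval (mpderiv w \<Psi>) z = t $ w) \<and> meval f z = r a)"
      by blast
  qed
qed

section \<open>Polynomials in two real variables along uncountable sets\<close>

text \<open>
  A polynomial in two variables is an element of \<open>\<real>[v][Z]\<close>; its value at \<open>(v, Z)\<close>
  comes from evaluating the outer variable at a constant polynomial first.
\<close>

definition eval2 :: "real poly poly \<Rightarrow> real \<Rightarrow> real \<Rightarrow> real" where
  "eval2 R Z v = poly (poly R [:Z:]) v"

lemma eval2_zero [simp]: "eval2 0 Z v = 0"
  by (simp add: eval2_def)

lemma eval2_pCons [simp]: "eval2 (pCons a R) Z v = poly a v + Z * eval2 R Z v"
  by (simp add: eval2_def)

lemma eval2_add [simp]: "eval2 (R + S) Z v = eval2 R Z v + eval2 S Z v"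
  by (simp add: eval2_def)

lemma eval2_mult [simp]: "eval2 (R * S) Z v = eval2 R Z v * eval2 S Z v"
  by (simp add: eval2_def)

lemma eval2_sum: "eval2 (\<Sum>i\<in>I. R i) Z v = (\<Sum>i\<in>I. eval2 (R i) Z v)"
  by (induction I rule: infinite_finite_induct) auto

lemma eval2_monom: "eval2 (monom a b) Z v = poly a v * Z ^ b"
  by (simp add: eval2_def poly_monom)

lemma tendsto_eval2:
  assumes "(h \<longlongrightarrow> Z) \<F>"
  shows "((\<lambda>n. eval2 R (h n) v) \<longlongrightarrow> eval2 R Z v) \<F>"
proof (induction R)
  case (pCons a R)
  then show ?case by (auto intro!: tendsto_intros assms)
qed simp

definition specialise :: "real \<Rightarrow> real poly poly \<Rightarrow> real poly" where
  "specialise v R = map_poly (\<lambda>p. poly p v) R"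

lemma coeff_specialise [simp]: "coeff (specialise v R) n = poly (coeff R n) v"
  by (simp add: specialise_def coeff_map_poly)

lemma specialise_pCons: "specialise v (pCons a R) = pCons (poly a v) (specialise v R)"
  by (rule poly_eqI) (simp add: coeff_pCons split: nat.split)

lemma poly_specialise: "poly (specialise v R) Z = eval2 R Z v"
proof (induction R)
  case (pCons a R)
  then show ?case by (simp add: specialise_pCons)
qed (simp add: specialise_def)

lemma specialise_pderiv: "specialise v (pderiv R) = pderiv (specialise v R)"
  by (rule poly_eqI) (simp add: coeff_pderiv)

lemma specialise_higher_pderiv: "specialise v ((pderiv ^^ n) R) = (pderiv ^^ n) (specialise v R)"
  by (induction n) (simp_all add: specialise_pderiv)

lemma finite_specialise_zero:
  assumes "R \<noteq> 0"
  shows "finite {v. specialise v R = 0}"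
proof (rule finite_subset)
  show "{v. specialise v R = 0} \<subseteq> {v. poly (lead_coeff R) v = 0}"
    by (auto simp flip: coeff_specialise)
  show "finite {v. poly (lead_coeff R) v = 0}"
    using assms by (intro poly_roots_finite) simp
qed

lemma nonzero_higher_derivative:
  fixes p :: "real poly"
  assumes "p \<noteq> 0"
  shows "\<exists>n. poly ((pderiv ^^ n) p) x \<noteq> 0"
  using assms
proof (induction "degree p" arbitrary: p rule: less_induct)
  case less
  show ?case
  proof (cases "degree p = 0")
    case True
    then obtain c where "p = [:c:]" by (rule degree_eq_zeroE)
    with less.prems show ?thesis by (intro exI [of _ 0]) simp
  next
    case False
    then have "pderiv p \<noteq> 0" "degree (pderiv p) < degree p"
      by (auto simp: pderiv_eq_0_iff degree_pderiv)
    then obtain n where "poly ((pderiv ^^ n) (pderiv p)) x \<noteq> 0" using less.hyps by blast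
    then have "poly ((pderiv ^^ Suc n) p) x \<noteq> 0" by (simp add: funpow_swap1)
    then show ?thesis by blast
  qed
qed

text \<open>
  As \<open>\<epsilon>\<close> tends to \<open>0\<close>, the solutions of an equation with coefficients polynomial in \<open>\<epsilon>\<close> and \<open>v\<close>
  tend to solutions of a nontrivial equation over \<open>\<real>[v]\<close>: divide by the largest possible
  power of \<open>\<epsilon>\<close> and put \<open>\<epsilon> = 0\<close>.
\<close>

lemma limit_equation:
  fixes q :: "nat \<Rightarrow> real poly poly"
  assumes "\<exists>b\<le>B. q b \<noteq> 0"
  shows "\<exists>R. R \<noteq> 0 \<and> (\<forall>v \<epsilon> Z Z\<^sub>0. (\<forall>n. \<epsilon> n \<noteq> 0) \<longrightarrow> \<epsilon> \<longlonglongrightarrow> 0 \<longrightarrow> Z \<longlonglongrightarrow> Z\<^sub>0 \<longrightarrow>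
    (\<forall>n. (\<Sum>b\<le>B. eval2 (q b) (\<epsilon> n) v * Z n ^ b) = 0) \<longrightarrow> eval2 R Z\<^sub>0 v = 0)"
proof -
  define k where "k = (LEAST k. \<exists>b\<le>B. coeff (q b) k \<noteq> 0)"
  have "\<exists>k. \<exists>b\<le>B. coeff (q b) k \<noteq> 0" using assms by (metis leading_coeff_0_iff)
  then have k: "\<exists>b\<le>B. coeff (q b) k \<noteq> 0" unfolding k_def by (rule LeastI_ex)
  have below: "coeff (q b) i = 0" if "b \<le> B" "i < k" for b i
    using not_less_Least [OF that(2) [unfolded k_def]] that(1) by blast
  define q' where "q' = (\<lambda>b. poly_shift k (q b))"
  have q': "q b = monom 1 k * q' b" if "b \<le> B" for b
    using below [OF that]
    by (intro poly_eqI) (auto simp: coeff_monom_mult q'_def coeff_poly_shift)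
  define R where "R = (\<Sum>b\<le>B. monom (coeff (q b) k) b)"
  have "coeff R b = coeff (q b) k" if "b \<le> B" for b
    using that by (simp add: R_def coeff_sum)
  then have "R \<noteq> 0" using k by force
  moreover have "eval2 R Z0 v = 0"
    if \<epsilon>: "\<And>n. \<epsilon> n \<noteq> 0" "\<epsilon> \<longlonglongrightarrow> 0" and Z: "Z \<longlonglongrightarrow> Z0"
      and eq: "\<And>n. (\<Sum>b\<le>B. eval2 (q b) (\<epsilon> n) v * Z n ^ b) = 0" for v \<epsilon> Z Z0
  proof -
    have "(\<Sum>b\<le>B. eval2 (q' b) (\<epsilon> n) v * Z n ^ b) = 0" for n
    proof -
      have "0 = (\<Sum>b\<le>B. \<epsilon> n ^ k * (eval2 (q' b) (\<epsilon> n) v * Z n ^ b))"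
        unfolding eq [of n, symmetric] by (intro sum.cong) (auto simp: q' eval2_monom)
      then have "\<epsilon> n ^ k * (\<Sum>b\<le>B. eval2 (q' b) (\<epsilon> n) v * Z n ^ b) = 0"
        by (simp add: sum_distrib_left)
      then show ?thesis using \<epsilon>(1) by simp
    qed
    moreover have "(\<lambda>n. \<Sum>b\<le>B. eval2 (q' b) (\<epsilon> n) v * Z n ^ b)
        \<longlonglongrightarrow> (\<Sum>b\<le>B. eval2 (q' b) 0 v * Z0 ^ b)"
      by (intro tendsto_intros tendsto_eval2 \<epsilon> Z)
    ultimately have "(\<Sum>b\<le>B. eval2 (q' b) 0 v * Z0 ^ b) = 0"
      by (simp add: LIMSEQ_const_iff)
    moreover have "eval2 (q' b) 0 v = poly (coeff (q b) k) v" for b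
      by (simp add: eval2_def q'_def poly_0_coeff_0 coeff_poly_shift)
    ultimately show ?thesis by (simp add: R_def eval2_sum eval2_monom)
  qed
  ultimately show ?thesis by (intro exI [of _ R]) auto
qed

lemma eval2_has_derivative:
  "\<exists>\<alpha>. ((\<lambda>y. eval2 S (snd y) (fst y)) has_derivative
      (\<lambda>y. \<alpha> * fst y + eval2 (pderiv S) Z v * snd y)) (at (v, Z))"
proof (induction S)
  case 0
  then show ?case by (intro exI [of _ 0]) simp
next
  case (pCons a S)
  then obtain \<alpha> where \<alpha>: "((\<lambda>y. eval2 S (snd y) (fst y)) has_derivative
      (\<lambda>y. \<alpha> * fst y + eval2 (pderiv S) Z v * snd y)) (at (v, Z))" by blast
  have a: "((\<lambda>y. poly a (fst y)) has_derivative (\<lambda>y. fst y * poly (pderiv a) v)) (at (v, Z))"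
  proof -
    have "(poly a has_derivative (\<lambda>h. h * poly (pderiv a) v)) (at (fst (v, Z)))"
      using poly_DERIV [of a v] by (simp add: has_field_derivative_def mult_commute_abs)
    then show ?thesis
      by (rule has_derivative_compose [OF has_derivative_fst [OF has_derivative_ident]])
  qed
  have "((\<lambda>y. poly a (fst y) + snd y * eval2 S (snd y) (fst y)) has_derivative
      (\<lambda>y. fst y * poly (pderiv a) v + (snd (v, Z) * (\<alpha> * fst y + eval2 (pderiv S) Z v * snd y)
        + snd y * eval2 S (snd (v, Z)) (fst (v, Z))))) (at (v, Z))"
    by (intro has_derivative_add a has_derivative_mult \<alpha> derivative_intros)
  then show ?case
    by (intro exI [of _ "poly (pderiv a) v + Z * \<alpha>"])
       (simp add: pderiv_pCons algebra_simps)
qed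

text \<open>
  At a simple root the derivative in \<open>Z\<close> dominates the linearisation, whose error is at most half
  of that derivative times the distance.
\<close>

lemma simple_root_lipschitz:
  assumes root: "eval2 S Z\<^sub>0 v\<^sub>0 = 0" and simple: "eval2 (pderiv S) Z\<^sub>0 v\<^sub>0 \<noteq> 0"
  obtains K d where "d > 0" "K \<ge> 0"
    "\<And>v Z. norm ((v, Z) - (v\<^sub>0, Z\<^sub>0)) < d \<Longrightarrow> eval2 S Z v = 0 \<Longrightarrow> \<bar>Z - Z\<^sub>0\<bar> \<le> K * \<bar>v - v\<^sub>0\<bar>"
proof -
  define \<beta> where "\<beta> = eval2 (pderiv S) Z\<^sub>0 v\<^sub>0"
  have \<beta>: "\<bar>\<beta>\<bar> > 0" using simple by (simp add: \<beta>_def)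
  obtain \<alpha> where der: "((\<lambda>y. eval2 S (snd y) (fst y)) has_derivative
      (\<lambda>y. \<alpha> * fst y + \<beta> * snd y)) (at (v\<^sub>0, Z\<^sub>0))"
    using eval2_has_derivative [of S Z\<^sub>0 v\<^sub>0] by (auto simp: \<beta>_def)
  obtain d where d: "d > 0" "\<And>y. norm (y - (v\<^sub>0, Z\<^sub>0)) < d \<Longrightarrow>
      norm (eval2 S (snd y) (fst y) - eval2 S Z\<^sub>0 v\<^sub>0
        - (\<alpha> * fst (y - (v\<^sub>0, Z\<^sub>0)) + \<beta> * snd (y - (v\<^sub>0, Z\<^sub>0)))) \<le> \<bar>\<beta>\<bar> / 2 * norm (y - (v\<^sub>0, Z\<^sub>0))"
    using conjunct2 [OF der [unfolded has_derivative_at_alt], THEN spec, THEN mp, of "\<bar>\<beta>\<bar> / 2"] \<beta>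
    by (simp only: fst_conv snd_conv half_gt_zero) blast
  show thesis
  proof (rule that [of d "2 * \<bar>\<alpha>\<bar> / \<bar>\<beta>\<bar> + 1"])
    fix v Z assume near: "norm ((v, Z) - (v\<^sub>0, Z\<^sub>0)) < d" and "eval2 S Z v = 0"
    then have "\<bar>\<alpha> * (v - v\<^sub>0) + \<beta> * (Z - Z\<^sub>0)\<bar> \<le> \<bar>\<beta>\<bar> / 2 * norm (v - v\<^sub>0, Z - Z\<^sub>0)"
      using d(2) [OF near] root by (simp add: abs_minus_commute algebra_simps)
    also have "\<dots> \<le> \<bar>\<beta>\<bar> / 2 * (\<bar>v - v\<^sub>0\<bar> + \<bar>Z - Z\<^sub>0\<bar>)"
      using norm_Pair_le [of "v - v\<^sub>0" "Z - Z\<^sub>0"] by (intro mult_left_mono) auto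
    finally have "\<bar>\<alpha> * (v - v\<^sub>0) + \<beta> * (Z - Z\<^sub>0)\<bar> \<le> \<bar>\<beta>\<bar> / 2 * (\<bar>v - v\<^sub>0\<bar> + \<bar>Z - Z\<^sub>0\<bar>)" .
    moreover have "\<bar>\<beta>\<bar> * \<bar>Z - Z\<^sub>0\<bar> \<le> \<bar>\<alpha> * (v - v\<^sub>0) + \<beta> * (Z - Z\<^sub>0)\<bar> + \<bar>\<alpha>\<bar> * \<bar>v - v\<^sub>0\<bar>"
      using abs_triangle_ineq4 [of "\<alpha> * (v - v\<^sub>0) + \<beta> * (Z - Z\<^sub>0)" "\<alpha> * (v - v\<^sub>0)"]
      by (simp add: abs_mult)
    ultimately have "\<bar>\<beta>\<bar> * \<bar>Z - Z\<^sub>0\<bar> \<le> (2 * \<bar>\<alpha>\<bar> + \<bar>\<beta>\<bar>) * \<bar>v - v\<^sub>0\<bar>"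
      by (simp add: algebra_simps)
    then have "\<bar>Z - Z\<^sub>0\<bar> \<le> (2 * \<bar>\<alpha>\<bar> + \<bar>\<beta>\<bar>) * \<bar>v - v\<^sub>0\<bar> / \<bar>\<beta>\<bar>"
      using \<beta> by (simp add: pos_le_divide_eq mult.commute)
    also have "\<dots> = (2 * \<bar>\<alpha>\<bar> / \<bar>\<beta>\<bar> + 1) * \<bar>v - v\<^sub>0\<bar>"
      using \<beta> by (simp add: field_simps)
    finally show "\<bar>Z - Z\<^sub>0\<bar> \<le> (2 * \<bar>\<alpha>\<bar> / \<bar>\<beta>\<bar> + 1) * \<bar>v - v\<^sub>0\<bar>" .
  qed (use d(1) in auto)
qed

lemma uncountable_has_own_limit_point:
  fixes P :: "'a::second_countable_topology set"
  assumes "uncountable P"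
  obtains x where "x \<in> P" "x islimpt P"
proof (rule ccontr)
  assume "\<not> thesis"
  with that have *: "\<not> x islimpt P" if "x \<in> P" for x using \<open>x \<in> P\<close> by blast
  obtain \<B> :: "'a set set" where \<B>: "countable \<B>" "topological_basis \<B>"
    using ex_countable_basis by blast
  have "\<forall>x\<in>P. \<exists>b\<in>\<B>. b \<inter> P = {x}"
  proof
    fix x assume x: "x \<in> P"
    with * have "\<not> x islimpt P" by simp
    then obtain T where T: "x \<in> T" "open T" "\<forall>y\<in>P. y \<in> T \<longrightarrow> y = x"
      by (auto simp: islimpt_def)
    obtain b where "b \<in> \<B>" "x \<in> b" "b \<subseteq> T" by (rule topological_basisE [OF \<B>(2) T(2,1)])
    then show "\<exists>b\<in>\<B>. b \<inter> P = {x}" using T(3) x by blast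
  qed
  then obtain \<phi> where \<phi>: "\<And>x. x \<in> P \<Longrightarrow> \<phi> x \<in> \<B> \<and> \<phi> x \<inter> P = {x}" by metis
  have "inj_on \<phi> P" by (rule inj_onI) (metis \<phi> singleton_inject)
  moreover have "countable (\<phi> ` P)" using \<phi> \<B>(1) by (meson countable_subset image_subsetI)
  ultimately have "countable P" using countable_image_inj_on by blast
  with assms show False by contradiction
qed

text \<open>
  On an uncountable set, functions that are algebraic over \<open>\<real>[v]\<close> satisfy a Lipschitz estimate
  along some sequence tending to a point of the set. Only countably many multiplicity patterns occur, so on an uncountable subset
  differentiating each equation often enough turns the values into simple roots. An uncountable
  subset of the graph contains one of its own limit points, and simple roots move with Lipschitz
  speed.
\<close>

lemma algebraic_curve_lipschitz_point:
  fixes x :: "real \<Rightarrow> real ^ 'v::finite"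
  assumes E: "uncountable E" and R: "\<And>j. R j \<noteq> 0"
    and alg: "\<And>v j. v \<in> E \<Longrightarrow> eval2 (R j) (x v $ j) v = 0"
  obtains v\<^sub>0 K where "v\<^sub>0 \<in> E" "K \<ge> 0" "\<And>\<eta>. \<eta> > 0 \<Longrightarrow>
    \<exists>v\<in>E. v \<noteq> v\<^sub>0 \<and> \<bar>v - v\<^sub>0\<bar> < \<eta> \<and> norm (x v - x v\<^sub>0) \<le> K * \<bar>v - v\<^sub>0\<bar>"
proof -
  define E0 where "E0 = E - (\<Union>j. {v. specialise v (R j) = 0})"
  have "uncountable E0"
    unfolding E0_def using E R
    by (intro uncountable_minus_countable countable_finite finite_UN_I finite_specialise_zero) auto
  define m where "m = (\<lambda>v j. LEAST n. poly ((pderiv ^^ n) (specialise v (R j))) (x v $ j) \<noteq> 0)"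
  have m: "poly ((pderiv ^^ m v j) (specialise v (R j))) (x v $ j) \<noteq> 0"
    "\<And>n. n < m v j \<Longrightarrow> poly ((pderiv ^^ n) (specialise v (R j))) (x v $ j) = 0"
    "m v j > 0" if v: "v \<in> E0" for v j
  proof -
    have "specialise v (R j) \<noteq> 0" using v by (auto simp: E0_def)
    then have "\<exists>n. poly ((pderiv ^^ n) (specialise v (R j))) (x v $ j) \<noteq> 0"
      by (rule nonzero_higher_derivative)
    then show 1: "poly ((pderiv ^^ m v j) (specialise v (R j))) (x v $ j) \<noteq> 0"
      unfolding m_def by (rule LeastI_ex)
    show "poly ((pderiv ^^ n) (specialise v (R j))) (x v $ j) = 0" if "n < m v j" for n
      using not_less_Least [OF that [unfolded m_def]] by blast
    have "poly (specialise v (R j)) (x v $ j) = 0"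
      using alg v by (simp add: poly_specialise E0_def)
    with 1 show "m v j > 0" by (metis funpow_0 gr0I)
  qed
  have "\<exists>\<mu>. uncountable {v\<in>E0. m v = \<mu>}"
  proof (rule ccontr)
    assume "\<not> ?thesis"
    then have "countable (\<Union>\<mu>. {v\<in>E0. m v = \<mu>})" by (intro countable_UN) auto
    moreover have "(\<Union>\<mu>. {v\<in>E0. m v = \<mu>}) = E0" by blast
    ultimately show False using \<open>uncountable E0\<close> by simp
  qed
  then obtain \<mu> where \<mu>: "uncountable {v\<in>E0. m v = \<mu>}" by blast
  define E1 where "E1 = {v\<in>E0. m v = \<mu>}"
  define S where "S = (\<lambda>j. (pderiv ^^ (\<mu> j - 1)) (R j))"
  have S: "eval2 (S j) (x v $ j) v = 0" "eval2 (pderiv (S j)) (x v $ j) v \<noteq> 0" if "v \<in> E1" for v j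
  proof -
    have v: "v \<in> E0" "m v j = \<mu> j" using that by (auto simp: E1_def)
    have pos: "\<mu> j > 0" using m(3) [OF v(1), of j] v(2) by simp
    show "eval2 (S j) (x v $ j) v = 0"
      using m(2) [OF v(1), of "\<mu> j - 1" j] v(2) pos
      by (simp add: S_def poly_specialise [symmetric] specialise_higher_pderiv)
    have "pderiv (S j) = (pderiv ^^ \<mu> j) (R j)"
      using pos unfolding S_def by (metis One_nat_def Suc_pred comp_apply funpow.simps(2))
    then show "eval2 (pderiv (S j)) (x v $ j) v \<noteq> 0"
      using m(1) [OF v(1), of j] v(2)
      by (simp add: poly_specialise [symmetric] specialise_higher_pderiv)
  qed
  have "inj_on (\<lambda>v. (v, x v)) E1" by (rule inj_onI) simp
  then have "uncountable ((\<lambda>v. (v, x v)) ` E1)"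
    using \<mu> countable_image_inj_on E1_def by blast
  then obtain v0 where v0: "v0 \<in> E1" "(v0, x v0) islimpt ((\<lambda>v. (v, x v)) ` E1)"
    using uncountable_has_own_limit_point by blast
  have "\<exists>K d. d > 0 \<and> K \<ge> 0 \<and> (\<forall>v Z. norm ((v, Z) - (v0, x v0 $ j)) < d \<longrightarrow>
      eval2 (S j) Z v = 0 \<longrightarrow> \<bar>Z - x v0 $ j\<bar> \<le> K * \<bar>v - v0\<bar>)" for j
    using simple_root_lipschitz [OF S [OF v0(1)], of j] by metis
  then obtain K d where Kd: "\<And>j. d j > 0" "\<And>j. K j \<ge> 0"
    "\<And>j v Z. norm ((v, Z) - (v0, x v0 $ j)) < d j \<Longrightarrow>
      eval2 (S j) Z v = 0 \<Longrightarrow> \<bar>Z - x v0 $ j\<bar> \<le> K j * \<bar>v - v0\<bar>"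
    by metis
  show thesis
  proof (rule that [of v0 "\<Sum>j\<in>UNIV. K j"])
    show "v0 \<in> E" using v0 by (auto simp: E1_def E0_def)
    show "(\<Sum>j\<in>UNIV. K j) \<ge> 0" using Kd(2) by (simp add: sum_nonneg)
    fix \<eta> :: real assume \<eta>: "\<eta> > 0"
    define \<rho> where "\<rho> = Min (insert \<eta> (range d))"
    have \<rho>: "\<rho> > 0" "\<rho> \<le> \<eta>" "\<And>j. \<rho> \<le> d j"
      using \<eta> Kd(1) by (auto simp: \<rho>_def intro: min.coboundedI2)
    obtain y where "y \<in> (\<lambda>v. (v, x v)) ` E1" "y \<noteq> (v0, x v0)" "dist y (v0, x v0) < \<rho>"
      using v0(2) \<rho>(1) unfolding islimpt_approachable by blast
    then obtain v where v: "v \<in> E1" "(v, x v) \<noteq> (v0, x v0)" "dist (v, x v) (v0, x v0) < \<rho>"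
      by blast
    have near: "norm (v - v0, x v - x v0) < \<rho>" using v(3) by (simp add: dist_norm)
    have "\<bar>x v $ j - x v0 $ j\<bar> \<le> K j * \<bar>v - v0\<bar>" for j
    proof (rule Kd(3))
      have "norm ((v, x v $ j) - (v0, x v0 $ j)) \<le> norm (v - v0, x v - x v0)"
        unfolding diff_Pair norm_Pair using component_le_norm_cart [of "x v - x v0" j]
        by (intro real_sqrt_le_mono add_mono power_mono) auto
      then show "norm ((v, x v $ j) - (v0, x v0 $ j)) < d j" using near \<rho>(3) [of j] by simp
      show "eval2 (S j) (x v $ j) v = 0" using S v(1) by blast
    qed
    then have "(\<Sum>j\<in>UNIV. \<bar>(x v - x v0) $ j\<bar>) \<le> (\<Sum>j\<in>UNIV. K j * \<bar>v - v0\<bar>)"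
      by (intro sum_mono) simp
    then have "norm (x v - x v0) \<le> (\<Sum>j\<in>UNIV. K j) * \<bar>v - v0\<bar>"
      using norm_le_l1_cart [of "x v - x v0"] by (simp add: sum_distrib_right)
    moreover have "v \<noteq> v0" using v(2) by auto
    moreover have "\<bar>v - v0\<bar> < \<eta>"
      using near \<rho>(2) norm_fst_le [of "v - v0" "x v - x v0"] by simp
    moreover have "v \<in> E" using v(1) by (auto simp: E1_def E0_def)
    ultimately show "\<exists>v\<in>E. v \<noteq> v0 \<and> \<bar>v - v0\<bar> < \<eta> \<and> norm (x v - x v0) \<le> (\<Sum>j\<in>UNIV. K j) * \<bar>v - v0\<bar>"
      by blast
  qed
qed

section \<open>Critical values of a polynomial\<close>

lemma two_polys_common_nonvanishing:
  assumes "meval p x \<noteq> 0" "meval q y \<noteq> 0"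
  shows "\<exists>z. meval p z \<noteq> 0 \<and> meval q z \<noteq> 0"
proof -
  \<comment> \<open>Restricted to the line through the two points, both are nonzero polynomials in one variable.\<close>
  define \<theta> where "\<theta> = (\<lambda>v. [:x $ v, y $ v - x $ v:])"
  have line: "\<exists>u. \<forall>s. poly u s = meval r (\<chi> v. poly (\<theta> v) s)" for r
    by (rule mpoly_substitution [where \<kappa> = "\<lambda>c. [:c:]"]) auto
  obtain u where u: "\<And>s. poly u s = meval p (\<chi> v. poly (\<theta> v) s)" using line by blast
  obtain w where w: "\<And>s. poly w s = meval q (\<chi> v. poly (\<theta> v) s)" using line by blast
  have "poly u 0 \<noteq> 0" "poly w 1 \<noteq> 0" using assms by (simp_all add: u w \<theta>_def)
  then have "u * w \<noteq> 0" by auto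
  then obtain s where "poly (u * w) s \<noteq> 0" using poly_all_0_iff_0 by blast
  then show ?thesis using u w by auto
qed

lemma finite_polys_common_nonvanishing:
  fixes Q :: "'v::finite mpoly set"
  assumes "finite Q" "0 \<notin> Q"
  shows "\<exists>t. \<forall>q\<in>Q. meval q t \<noteq> 0"
  using assms
proof (induction Q rule: finite_induct)
  case (insert q Q)
  then obtain t where "\<forall>r\<in>Q. meval r t \<noteq> 0" by auto
  then have "meval (\<Prod>r\<in>Q. r) t \<noteq> 0" using insert(1) by simp
  moreover obtain s where "meval q s \<noteq> 0"
    using nonzero_mpoly_nonvanishing [of q "\<lambda>_. UNIV"] insert.prems by (auto simp: infinite_UNIV_char_0)
  ultimately obtain z where "meval q z \<noteq> 0" "meval (\<Prod>r\<in>Q. r) z \<noteq> 0"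
    using two_polys_common_nonvanishing by blast
  then show ?case using insert(1) by auto
qed simp

text \<open>
  The point is a minimum of \<open>G + (L - v)\<^sup>2 + \<epsilon> |z - \<gamma>|\<^sup>2\<close>: comparison with \<open>y\<close>, where only the
  penalty term is nonzero, bounds its position and its value, and the equations say that the
  gradient vanishes.
\<close>

lemma regularised_minimum:
  fixes G L :: "'v::finite mpoly" and \<gamma> y :: "real ^ 'v"
  assumes \<epsilon>: "\<epsilon> > 0" and nonneg: "\<And>z. meval G z \<ge> 0" and y: "meval G y = 0" "meval L y = v"
  obtains z where "norm (z - \<gamma>) \<le> norm (y - \<gamma>)"
    "meval G z + (meval L z - v)\<^sup>2 \<le> \<epsilon> * (norm (y - \<gamma>))\<^sup>2"
    "\<And>i. meval (mpderiv i G) z + 2 * (meval L z - v) * meval (mpderiv i L) z + 2 * \<epsilon> * z $ i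
      = 2 * \<epsilon> * \<gamma> $ i"
proof -
  define h where "h = (\<lambda>z. meval G z + (meval L z - v)\<^sup>2 + \<epsilon> * ((z - \<gamma>) \<bullet> (z - \<gamma>)))"
  \<comment> \<open>On the larger ball of radius \<open>r + 1\<close> the minimum is interior.\<close>
  define r where "r = norm (y - \<gamma>)"
  have yU: "y \<in> cball \<gamma> (r + 1)" by (simp add: r_def dist_norm norm_minus_commute)
  have "continuous_on (cball \<gamma> (r + 1)) h" unfolding h_def by (intro continuous_intros)
  moreover have "cball \<gamma> (r + 1) \<noteq> {}" using yU by (metis empty_iff)
  ultimately have "\<exists>z\<in>cball \<gamma> (r + 1). \<forall>u\<in>cball \<gamma> (r + 1). h z \<le> h u"
    by (intro continuous_attains_inf compact_cball)
  then obtain z where z: "z \<in> cball \<gamma> (r + 1)" "\<And>u. u \<in> cball \<gamma> (r + 1) \<Longrightarrow> h z \<le> h u"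
    by (elim bexE) (rule that, assumption, erule bspec)
  have "meval G z + (meval L z - v)\<^sup>2 + \<epsilon> * (norm (z - \<gamma>))\<^sup>2 = h z"
    by (simp add: h_def power2_norm_eq_inner)
  also have "\<dots> \<le> h y" by (rule z(2) [OF yU])
  also have "h y = \<epsilon> * r\<^sup>2"
    by (simp add: h_def r_def power2_norm_eq_inner y)
  finally have hz: "meval G z + (meval L z - v)\<^sup>2 + \<epsilon> * (norm (z - \<gamma>))\<^sup>2 \<le> \<epsilon> * r\<^sup>2" .
  have "0 \<le> \<epsilon> * (norm (z - \<gamma>))\<^sup>2" "0 \<le> meval G z + (meval L z - v)\<^sup>2"
    using \<epsilon> nonneg by auto
  with hz have 1: "meval G z + (meval L z - v)\<^sup>2 \<le> \<epsilon> * r\<^sup>2"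
    and "\<epsilon> * (norm (z - \<gamma>))\<^sup>2 \<le> \<epsilon> * r\<^sup>2" by linarith+
  then have "(norm (z - \<gamma>))\<^sup>2 \<le> r\<^sup>2" using \<epsilon> by simp
  then have zr: "norm (z - \<gamma>) \<le> r" by (rule power2_le_imp_le) (simp add: r_def)
  then have zO: "z \<in> ball \<gamma> (r + 1)" by (simp add: dist_norm norm_minus_commute)
  have diff: "((\<lambda>z. z - \<gamma>) has_derivative (\<lambda>k. k - 0)) (at z)"
    by (intro has_derivative_diff has_derivative_ident has_derivative_const)
  have der: "(h has_derivative (\<lambda>k. (\<Sum>i\<in>UNIV. k $ i * meval (mpderiv i G) z)
      + 2 * (meval L z - v) * (\<Sum>i\<in>UNIV. k $ i * meval (mpderiv i L) z)
      + 2 * \<epsilon> * ((z - \<gamma>) \<bullet> k))) (at z)"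
    unfolding h_def
    by (rule has_derivative_eq_rhs [OF has_derivative_add [OF has_derivative_add [OF
            meval_has_derivative [of G] has_derivative_power [OF has_derivative_diff [OF
              meval_has_derivative [of L] has_derivative_const [of v]], of 2]]
            has_derivative_mult_right [OF has_derivative_inner [OF diff diff]]]])
       (simp add: fun_eq_iff inner_commute)
  have "(\<lambda>k. (\<Sum>i\<in>UNIV. k $ i * meval (mpderiv i G) z)
      + 2 * (meval L z - v) * (\<Sum>i\<in>UNIV. k $ i * meval (mpderiv i L) z)
      + 2 * \<epsilon> * ((z - \<gamma>) \<bullet> k)) = (\<lambda>k. 0)"
    by (rule differential_zero_maxmin [OF zO open_ball der]) (use z(2) in auto)
  then have "(\<Sum>j\<in>UNIV. axis i 1 $ j * meval (mpderiv j G) z)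
      + 2 * (meval L z - v) * (\<Sum>j\<in>UNIV. axis i 1 $ j * meval (mpderiv j L) z)
      + 2 * \<epsilon> * ((z - \<gamma>) \<bullet> axis i 1) = 0" for i
    by (rule fun_cong)
  then have "meval (mpderiv i G) z + 2 * (meval L z - v) * meval (mpderiv i L) z
      + 2 * \<epsilon> * ((z - \<gamma>) \<bullet> axis i 1) = 0" for i
    unfolding meval_derivative_unique [OF meval_has_derivative, symmetric] .
  then have "meval (mpderiv i G) z + 2 * (meval L z - v) * meval (mpderiv i L) z
      + 2 * \<epsilon> * z $ i = 2 * \<epsilon> * \<gamma> $ i" for i
    by (simp add: inner_axis algebra_simps)
  then show thesis using that [of z] zr 1 by (simp add: r_def)
qed

text \<open>
  The critical points of \<open>L\<close> with value \<open>v\<close> are the zeros of \<open>G + (L - v)\<^sup>2\<close>, where \<open>G\<close> is the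
  squared length of the gradient. Minimising \<open>G + (L - v)\<^sup>2 + \<epsilon> |z - \<gamma>|\<^sup>2\<close> selects, as \<open>\<epsilon>\<close>
  tends to \<open>0\<close>, one such point for each critical value \<open>v\<close>, and the gradient equations of the
  minimisers make each of its coordinates algebraic in \<open>v\<close>.
\<close>

lemma algebraic_selection_of_critical_points:
  fixes L :: "'v::finite mpoly"
  defines "C \<equiv> {z. \<forall>i. meval (mpderiv i L) z = 0}"
  obtains R :: "'v \<Rightarrow> real poly poly" and x
  where "\<And>j. R j \<noteq> 0" "\<And>v. v \<in> meval L ` C \<Longrightarrow> x v \<in> C \<and> meval L (x v) = v"
    "\<And>v j. v \<in> meval L ` C \<Longrightarrow> eval2 (R j) (x v $ j) v = 0"
proof -
  define G where "G = (\<Sum>i\<in>UNIV. mpderiv i L ^ 2)"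
  have G: "meval G z \<ge> 0" "meval G z = 0 \<longleftrightarrow> z \<in> C" for z
    by (simp_all add: G_def C_def sum_nonneg sum_nonneg_eq_0_iff)
  define F :: "'v + bool \<Rightarrow> ('v + bool) mpoly" where
    "F = (\<lambda>w. case w of
       Inl i \<Rightarrow> mrename Inl (mpderiv i G)
         + mConst 2 * (mrename Inl L - mVar (Inr True)) * mrename Inl (mpderiv i L)
         + mConst 2 * mVar (Inr False) * mVar (Inl i)
     | Inr b \<Rightarrow> mVar (Inr b))"
  have "\<forall>w. \<exists>d. F w \<in> polys_deg_le d" by (simp add: ex_deg_le)
  then obtain e' where e': "\<And>w. F w \<in> polys_deg_le (e' w)" by metis
  define e where "e = 2 + (\<Sum>w\<in>UNIV. e' w)"
  have e: "F w \<in> polys_deg_le e" for w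
    by (rule deg_le_mono [OF e'], unfold e_def, rule trans_le_add2, rule member_le_sum) auto
  have e2: "e \<ge> 2" by (simp add: e_def)
  define B where "B = e ^ CARD('v + bool)"
  have "\<forall>j. \<exists>p. (\<exists>b\<le>B. p b \<noteq> 0) \<and>
      (\<forall>\<zeta>. (\<Sum>b\<le>B. meval (p b) (\<chi> w. meval (F w) \<zeta>) * (\<zeta> $ Inl j) ^ b) = 0)"
  proof
    fix j
    obtain p b where "b \<le> B" "p b \<noteq> 0"
      "\<And>\<zeta>. (\<Sum>b\<le>B. meval (p b) (\<chi> w. meval (F w) \<zeta>) * meval (mVar (Inl j)) \<zeta> ^ b) = 0"
      by (rule algebraic_dependence [OF e e2, where f = "mVar (Inl j)", folded B_def]) (rule that)
    then show "\<exists>p. (\<exists>b\<le>B. p b \<noteq> 0) \<and>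
      (\<forall>\<zeta>. (\<Sum>b\<le>B. meval (p b) (\<chi> w. meval (F w) \<zeta>) * (\<zeta> $ Inl j) ^ b) = 0)"
      by (intro exI [of _ p]) (auto simp only: meval_mVar)
  qed
  from choice [OF this] obtain P where P: "\<forall>j. (\<exists>b\<le>B. P j b \<noteq> 0) \<and>
      (\<forall>\<zeta>. (\<Sum>b\<le>B. meval (P j b) (\<chi> w. meval (F w) \<zeta>) * (\<zeta> $ Inl j) ^ b) = 0)" ..
  have rel: "(\<Sum>b\<le>B. meval (P j b) (\<chi> w. meval (F w) \<zeta>) * (\<zeta> $ Inl j) ^ b) = 0" for j \<zeta>
    using P by simp
  have "\<forall>j. \<exists>b. b \<le> B \<and> P j b \<noteq> 0" using P by simp
  from choice [OF this] obtain b where "\<forall>j. b j \<le> B \<and> P j (b j) \<noteq> 0" ..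
  then have b: "b j \<le> B" "P j (b j) \<noteq> 0" for j by simp_all
  \<comment> \<open>The centre \<open>\<gamma>\<close> has to be chosen so that none of the relations becomes trivial.\<close>
  have "(mVar (Inr False) :: ('v + bool) mpoly) \<noteq> 0"
    using meval_mVar [of "Inr False" "1 :: real ^ ('v + bool)"] by fastforce
  moreover have "0 \<notin> range (\<lambda>j. P j (b j))"
  proof
    assume "0 \<in> range (\<lambda>j. P j (b j))"
    then obtain j where "P j (b j) = 0" by force
    with b(2) [of j] show False ..
  qed
  ultimately obtain t where t: "t $ Inr False \<noteq> 0" "\<And>j. meval (P j (b j)) t \<noteq> 0"
    using finite_polys_common_nonvanishing [of "insert (mVar (Inr False)) (range (\<lambda>j. P j (b j)))"]
    by auto
  define \<gamma> :: "real ^ 'v" where "\<gamma> = (\<chi> i. t $ Inl i / (2 * t $ Inr False))"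
  define \<tau> :: "real \<Rightarrow> real \<Rightarrow> real ^ ('v + bool)" where
    "\<tau> = (\<lambda>\<epsilon> v. \<chi> w. case w of Inl i \<Rightarrow> 2 * \<epsilon> * \<gamma> $ i | Inr c \<Rightarrow> if c then v else \<epsilon>)"
  have \<tau>t: "\<tau> (t $ Inr False) (t $ Inr True) = t"
    using t(1) by (simp add: vec_eq_iff \<tau>_def \<gamma>_def split: sum.split)
  define \<theta> :: "'v + bool \<Rightarrow> real poly poly" where
    "\<theta> = (\<lambda>w. case w of Inl i \<Rightarrow> [:0, [:2 * \<gamma> $ i:]:] | Inr c \<Rightarrow> if c then [:[:0, 1:]:] else [:0, 1:])"
  have "\<exists>q. \<forall>y. eval2 q (fst y) (snd y) = meval p (\<chi> w. eval2 (\<theta> w) (fst y) (snd y))" for p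
    by (rule mpoly_substitution [where \<kappa> = "\<lambda>c. [:[:c:]:]"
          and \<E> = "\<lambda>q y. eval2 q (fst y) (snd y)"]) auto
  moreover have "(\<chi> w. eval2 (\<theta> w) \<epsilon> v) = \<tau> \<epsilon> v" for \<epsilon> v
    by (simp add: vec_eq_iff \<tau>_def \<theta>_def one_pCons split: sum.split)
  ultimately have "\<exists>q. \<forall>y. eval2 q (fst y) (snd y) = meval p (\<tau> (fst y) (snd y))" for p
    by simp
  then have "\<exists>q. \<forall>\<epsilon> v. eval2 q \<epsilon> v = meval p (\<tau> \<epsilon> v)" for p
    by (simp add: split_paired_all)
  then have "\<forall>p. \<exists>q. \<forall>\<epsilon> v. eval2 q \<epsilon> v = meval p (\<tau> \<epsilon> v)" by blast
  from choice [OF this] obtain Q where Q: "\<forall>p. \<forall>\<epsilon> v. eval2 (Q p) \<epsilon> v = meval p (\<tau> \<epsilon> v)" ..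
  define q where "q = (\<lambda>j b. Q (P j b))"
  have q: "eval2 (q j b) \<epsilon> v = meval (P j b) (\<tau> \<epsilon> v)" for j b \<epsilon> v
    using Q by (simp add: q_def)
  have q_nonzero: "\<exists>b\<le>B. q j b \<noteq> 0" for j
  proof -
    have "eval2 (q j (b j)) (t $ Inr False) (t $ Inr True) \<noteq> 0" using t(2) by (simp add: q \<tau>t)
    then show ?thesis using b(1) by (metis eval2_zero)
  qed
  have "\<forall>j. \<exists>R. R \<noteq> 0 \<and> (\<forall>v \<epsilon> Z Z0. (\<forall>n. \<epsilon> n \<noteq> 0) \<longrightarrow> \<epsilon> \<longlonglongrightarrow> 0 \<longrightarrow> Z \<longlonglongrightarrow> Z0 \<longrightarrow>
      (\<forall>n. (\<Sum>b\<le>B. eval2 (q j b) (\<epsilon> n) v * Z n ^ b) = 0) \<longrightarrow> eval2 R Z0 v = 0)"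
    by (intro allI limit_equation q_nonzero)
  from choice [OF this] obtain R where R: "\<forall>j. R j \<noteq> 0 \<and> (\<forall>v \<epsilon> Z Z0. (\<forall>n. \<epsilon> n \<noteq> 0) \<longrightarrow>
      \<epsilon> \<longlonglongrightarrow> 0 \<longrightarrow> Z \<longlonglongrightarrow> Z0 \<longrightarrow>
      (\<forall>n. (\<Sum>b\<le>B. eval2 (q j b) (\<epsilon> n) v * Z n ^ b) = 0) \<longrightarrow> eval2 (R j) Z0 v = 0)" ..
  have "\<exists>x. x \<in> C \<and> meval L x = v \<and> (\<forall>j. eval2 (R j) (x $ j) v = 0)" if v: "v \<in> meval L ` C" for v
  proof -
    obtain y where y: "y \<in> C" "meval L y = v" using v by auto
    define \<epsilon> where "\<epsilon> = (\<lambda>n. inverse (real (Suc n)))"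
    have \<epsilon>: "\<epsilon> n > 0" for n by (simp add: \<epsilon>_def)
    have \<epsilon>_lim: "\<epsilon> \<longlonglongrightarrow> 0" unfolding \<epsilon>_def by (rule LIMSEQ_inverse_real_of_nat)
    have "\<exists>z. norm (z - \<gamma>) \<le> norm (y - \<gamma>) \<and>
      meval G z + (meval L z - v)\<^sup>2 \<le> \<epsilon> n * (norm (y - \<gamma>))\<^sup>2 \<and>
      (\<forall>i. meval (mpderiv i G) z + 2 * (meval L z - v) * meval (mpderiv i L) z + 2 * \<epsilon> n * z $ i
        = 2 * \<epsilon> n * \<gamma> $ i)" for n
      by (rule regularised_minimum [OF \<epsilon> [of n] G(1), of y L v \<gamma>]) (use y G(2) in auto)
    then obtain z where z: "\<And>n. norm (z n - \<gamma>) \<le> norm (y - \<gamma>)"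
      "\<And>n. meval G (z n) + (meval L (z n) - v)\<^sup>2 \<le> \<epsilon> n * (norm (y - \<gamma>))\<^sup>2"
      "\<And>n i. meval (mpderiv i G) (z n) + 2 * (meval L (z n) - v) * meval (mpderiv i L) (z n)
        + 2 * \<epsilon> n * z n $ i = 2 * \<epsilon> n * \<gamma> $ i"
      by metis
    have "\<forall>n. z n \<in> cball \<gamma> (norm (y - \<gamma>))"
      using z(1) by (simp add: dist_norm norm_minus_commute)
    then obtain x s where s: "strict_mono s" "(z \<circ> s) \<longlonglongrightarrow> x"
      using compact_cball [of \<gamma> "norm (y - \<gamma>)"] unfolding compact_def by metis
    have \<epsilon>s: "(\<lambda>n. \<epsilon> (s n)) \<longlonglongrightarrow> 0"
      using LIMSEQ_subseq_LIMSEQ [OF \<epsilon>_lim s(1)] by (simp add: comp_def)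
    have zs: "(\<lambda>n. z (s n)) \<longlonglongrightarrow> x" using s(2) by (simp add: comp_def)
    have cont: "(\<lambda>n. meval p (z (s n))) \<longlonglongrightarrow> meval p x" for p
      using continuous_on_meval [of UNIV p] zs
      by (auto simp: continuous_on_eq_continuous_at intro: isCont_tendsto_compose)
    have "meval G x + (meval L x - v)\<^sup>2 \<le> 0 * (norm (y - \<gamma>))\<^sup>2"
    proof (rule LIMSEQ_le)
      show "(\<lambda>n. meval G (z (s n)) + (meval L (z (s n)) - v)\<^sup>2) \<longlonglongrightarrow> meval G x + (meval L x - v)\<^sup>2"
        by (intro tendsto_intros cont)
      show "(\<lambda>n. \<epsilon> (s n) * (norm (y - \<gamma>))\<^sup>2) \<longlonglongrightarrow> 0 * (norm (y - \<gamma>))\<^sup>2"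
        by (intro tendsto_intros \<epsilon>s)
    qed (use z(2) in blast)
    then have "meval G x = 0" "(meval L x - v)\<^sup>2 = 0"
      using G(1) [of x] zero_le_power2 [of "meval L x - v"] by linarith+
    then have "x \<in> C" "meval L x = v" using G(2) by auto
    moreover have "eval2 (R j) (x $ j) v = 0" for j
    proof (rule R [THEN spec, of j, THEN conjunct2, rule_format])
      show "\<epsilon> (s n) \<noteq> 0" for n using \<epsilon> [of "s n"] by simp
      show "(\<lambda>n. \<epsilon> (s n)) \<longlonglongrightarrow> 0" by (rule \<epsilon>s)
      show "(\<lambda>n. z (s n) $ j) \<longlonglongrightarrow> x $ j" by (intro tendsto_vec_nth zs)
      show "(\<Sum>b\<le>B. eval2 (q j b) (\<epsilon> (s n)) v * (z (s n) $ j) ^ b) = 0" for n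
      proof -
        define \<zeta> :: "real ^ ('v + bool)" where
          "\<zeta> = (\<chi> w. case w of Inl i \<Rightarrow> z (s n) $ i | Inr c \<Rightarrow> if c then v else \<epsilon> (s n))"
        have x_part: "(\<chi> i. \<zeta> $ Inl i) = z (s n)" by (simp add: \<zeta>_def vec_eq_iff)
        have "meval (F w) \<zeta> = \<tau> (\<epsilon> (s n)) v $ w" for w
          using z(3) [of _ "s n"]
          by (cases w) (simp_all add: F_def x_part, simp_all add: \<zeta>_def \<tau>_def)
        then have "(\<chi> w. meval (F w) \<zeta>) = \<tau> (\<epsilon> (s n)) v" by (simp add: vec_eq_iff)
        then show ?thesis
          using rel [of j \<zeta>] by (simp add: q) (simp add: \<zeta>_def)
      qed
    qed
    ultimately show ?thesis by blast
  qed
  then obtain x where "\<And>v. v \<in> meval L ` C \<Longrightarrow>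
      x v \<in> C \<and> meval L (x v) = v \<and> (\<forall>j. eval2 (R j) (x v $ j) v = 0)" by metis
  then show thesis using that [of R x] R by blast
qed

text \<open>
  A Sard theorem for polynomials: near a critical point the increments of \<open>L\<close> are of smaller order
  than the distances, while at some accumulation point of an uncountable set of critical values the
  selected critical points satisfy a Lipschitz estimate in terms of the values.
\<close>

theorem countable_critical_values:
  fixes L :: "'v::finite mpoly"
  shows "countable (meval L ` {z. \<forall>i. meval (mpderiv i L) z = 0})"
proof (rule ccontr)
  define C where "C = {z. \<forall>i. meval (mpderiv i L) z = 0}"
  assume "\<not> countable (meval L ` {z. \<forall>i. meval (mpderiv i L) z = 0})"
  then have unc: "uncountable (meval L ` C)" by (simp add: C_def)
  obtain R :: "'v \<Rightarrow> real poly poly" and x where R: "\<And>j. R j \<noteq> 0"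
    and x: "\<And>v. v \<in> meval L ` C \<Longrightarrow> x v \<in> C \<and> meval L (x v) = v"
    and alg: "\<And>v j. v \<in> meval L ` C \<Longrightarrow> eval2 (R j) (x v $ j) v = 0"
    by (rule algebraic_selection_of_critical_points [of L, folded C_def]) (rule that)
  obtain v0 K where v0: "v0 \<in> meval L ` C" "K \<ge> 0" "\<And>\<eta>. \<eta> > 0 \<Longrightarrow>
    \<exists>v\<in>meval L ` C. v \<noteq> v0 \<and> \<bar>v - v0\<bar> < \<eta> \<and> norm (x v - x v0) \<le> K * \<bar>v - v0\<bar>"
    using algebraic_curve_lipschitz_point [OF unc, of R x] R alg by blast
  have "(meval L has_derivative (\<lambda>h. \<Sum>i\<in>UNIV. h $ i * meval (mpderiv i L) (x v0))) (at (x v0))"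
    by (rule meval_has_derivative)
  then have "(meval L has_derivative (\<lambda>h. 0)) (at (x v0))"
    using x [OF v0(1)] by (simp add: C_def)
  then have "\<exists>d>0. \<forall>y. norm (y - x v0) < d \<longrightarrow>
      norm (meval L y - meval L (x v0) - 0) \<le> inverse (2 * (K + 1)) * norm (y - x v0)"
    using v0(2) unfolding has_derivative_at_alt by simp
  then obtain d where d: "d > 0" "\<And>y. norm (y - x v0) < d \<Longrightarrow>
      \<bar>meval L y - meval L (x v0)\<bar> \<le> inverse (2 * (K + 1)) * norm (y - x v0)"
    by auto
  have "d / (K + 1) > 0" using d(1) v0(2) by simp
  then obtain v where v: "v \<in> meval L ` C" "v \<noteq> v0" "\<bar>v - v0\<bar> < d / (K + 1)"
    "norm (x v - x v0) \<le> K * \<bar>v - v0\<bar>" using v0(3) by blast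
  have pos: "\<bar>v - v0\<bar> > 0" using v(2) by simp
  have le: "norm (x v - x v0) \<le> (K + 1) * \<bar>v - v0\<bar>"
    using v(4) pos by (simp add: distrib_right)
  also have "\<dots> < d" using v(3) v0(2) by (simp add: pos_less_divide_eq mult.commute)
  finally have "\<bar>v - v0\<bar> \<le> inverse (2 * (K + 1)) * norm (x v - x v0)"
    using d(2) [of "x v"] x v(1) v0(1) by simp
  also have "\<dots> \<le> inverse (2 * (K + 1)) * ((K + 1) * \<bar>v - v0\<bar>)"
    using le v0(2) by (intro mult_left_mono) auto
  also have "\<dots> = \<bar>v - v0\<bar> / 2" using v0(2) by (simp add: field_simps)
  finally show False using pos by simp
qed

section \<open>Fritz John points\<close>

lemma zero_set_fritz_john_pos_iff:
  fixes f :: "'n::finite mpoly" and g :: "'m::finite \<Rightarrow> 'n mpoly"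
  shows "z \<in> zero_set (fritz_john_pos f g) \<longleftrightarrow>
    (\<forall>i. (z $ Inr None)\<^sup>2 * meval (mpderiv i f) (x_part z)
       = (\<Sum>j\<in>UNIV. (z $ Inr (Some j))\<^sup>2 * meval (mpderiv i (g j)) (x_part z))) \<and>
    (\<forall>j. z $ Inr (Some j) = 0 \<or> meval (g j) (x_part z) = 0) \<and>
    (z $ Inr None)\<^sup>2 + (\<Sum>j\<in>UNIV. (z $ Inr (Some j))\<^sup>2) = 1"
proof -
  have "(\<Sum>j\<in>UNIV. (z $ Inr j)\<^sup>2) = (z $ Inr None)\<^sup>2 + (\<Sum>j\<in>UNIV. (z $ Inr (Some j))\<^sup>2)"
    by (simp add: UNIV_option_conv sum.reindex)
  then show ?thesis
    unfolding zero_set_def fritz_john_pos_def lam_def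
    by (auto simp: split_sum_all split: sum.split)
qed

text \<open>
  With \<open>\<lambda>\<^sub>0 = 0\<close> the squares of the remaining multipliers are the weights of a convex
  combination of all columns of the matrix that vanishes.
\<close>

lemma abnormal_point_in_crit_pos:
  fixes f :: "'n::finite mpoly" and g :: "'m::finite \<Rightarrow> 'n mpoly"
  assumes z: "z \<in> zero_set (fritz_john_pos f g)" and null: "z $ Inr None = 0"
  shows "x_part z \<in> crit_pos g"
proof -
  define M where "M = phi_mat g (x_part z)"
  define a where "a = (\<lambda>j. (z $ Inr (Some j))\<^sup>2)"
  have grad: "(\<Sum>j\<in>UNIV. a j * meval (mpderiv i (g j)) (x_part z)) = 0" for i
    using z null by (simp add: zero_set_fritz_john_pos_iff a_def)
  have compl: "a j * meval (g j) (x_part z) = 0" for j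
    using z by (auto simp: zero_set_fritz_john_pos_iff a_def)
  have "(\<Sum>j\<in>UNIV. a j *\<^sub>R column j M) = 0"
  proof (subst vec_eq_iff, rule allI)
    fix r
    show "(\<Sum>j\<in>UNIV. a j *\<^sub>R column j M) $ r = 0 $ r"
    proof (cases r)
      case (Inl i)
      then show ?thesis using grad [of i] by (simp add: column_def M_def phi_mat_def)
    next
      case (Inr k)
      have "a j * (meval (g j) (x_part z) * axis j 1 $ k) = 0" for j
        using compl [of j] by auto
      then show ?thesis
        using Inr by (auto simp: column_def M_def phi_mat_def intro!: sum.neutral)
    qed
  qed
  moreover have "(\<Sum>j\<in>UNIV. a j *\<^sub>R column j M) \<in> convex hull ((\<lambda>j. column j M) ` UNIV)"
  proof (rule convex_sum)
    show "(\<Sum>j\<in>UNIV. a j) = 1"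
      using z null by (simp add: zero_set_fritz_john_pos_iff a_def)
  qed (auto simp: a_def hull_inc)
  ultimately have hull: "0 \<in> convex hull ((\<lambda>j. column j M) ` UNIV)" by simp
  define T where "T = {card J | J :: 'm set. 0 \<notin> convex hull ((\<lambda>j. column j M) ` J)}"
  have bound: "n < CARD('m)" if n: "n \<in> T" for n
  proof -
    obtain J :: "'m set" where J: "n = card J" "0 \<notin> convex hull ((\<lambda>j. column j M) ` J)"
      using n by (auto simp: T_def)
    with hull have "J \<noteq> UNIV" by blast
    then show ?thesis using J(1) by (simp add: psubset_card_mono psubset_eq)
  qed
  have "card ({} :: 'm set) \<in> T"
    unfolding T_def by (rule CollectI, rule exI [of _ "{}"]) simp
  moreover have "finite T" using bound by (meson finite_nat_set_iff_bounded)
  ultimately have "Max T < CARD('m)" using bound by (subst Max_less_iff) auto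
  then show ?thesis by (simp add: crit_pos_def pos_rank_def M_def T_def)
qed

lemma meval_x_block_has_derivative:
  fixes p :: "'n::finite mpoly" and u :: "real ^ ('n + 'm::finite)"
  shows "((\<lambda>z. meval p (\<chi> i. z $ Inl i)) has_derivative
    (\<lambda>k. \<Sum>i\<in>UNIV. k $ Inl i * meval (mpderiv i p) (\<chi> i. u $ Inl i))) (at u)"
proof -
  have "linear (\<lambda>z :: real ^ ('n + 'm). \<chi> i. z $ Inl i)"
    by (rule linearI) (simp_all add: vec_eq_iff)
  then have "((\<lambda>z :: real ^ ('n + 'm). \<chi> i. z $ Inl i) has_derivative (\<lambda>z. \<chi> i. z $ Inl i)) (at u)"
    by (intro bounded_linear_imp_has_derivative linear_linear [THEN iffD2])
  from has_derivative_compose [OF this meval_has_derivative [of p]]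
  show ?thesis by simp
qed

text \<open>
  With \<open>\<lambda>\<^sub>0 \<noteq> 0\<close> the quotients \<open>\<lambda>\<^sub>j / \<lambda>\<^sub>0\<close> complete \<open>x\<close> to a critical point of the Lagrangian
  with squared multipliers. The value of the Lagrangian there is \<open>f(x)\<close> by complementarity.
\<close>

definition lagrangian :: "'n::finite mpoly \<Rightarrow> ('m::finite \<Rightarrow> 'n mpoly) \<Rightarrow> ('n + 'm) mpoly" where
  "lagrangian f g = mrename Inl f - (\<Sum>j\<in>UNIV. mVar (Inr j) ^ 2 * mrename Inl (g j))"

lemma normal_point_value_critical:
  fixes f :: "'n::finite mpoly" and g :: "'m::finite \<Rightarrow> 'n mpoly"
  assumes z: "z \<in> zero_set (fritz_john_pos f g)" and nonnull: "z $ Inr None \<noteq> 0"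
  shows "meval f (x_part z) \<in> meval (lagrangian f g) ` {u. \<forall>w. meval (mpderiv w (lagrangian f g)) u = 0}"
proof -
  define l where "l = z $ Inr None"
  define u :: "real ^ ('n + 'm)" where
    "u = (\<chi> w. case w of Inl i \<Rightarrow> x_part z $ i | Inr j \<Rightarrow> z $ Inr (Some j) / l)"
  have x: "(\<chi> i. u $ Inl i) = x_part z" by (simp add: u_def vec_eq_iff)
  have compl: "u $ Inr j * meval (g j) (x_part z) = 0" for j
    using z by (auto simp: zero_set_fritz_john_pos_iff u_def)
  have grad: "meval (mpderiv i f) (x_part z)
      = (\<Sum>j\<in>UNIV. (u $ Inr j)\<^sup>2 * meval (mpderiv i (g j)) (x_part z))" for i
  proof -
    have "l\<^sup>2 * meval (mpderiv i f) (x_part z)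
        = (\<Sum>j\<in>UNIV. (z $ Inr (Some j))\<^sup>2 * meval (mpderiv i (g j)) (x_part z))"
      using z by (simp add: zero_set_fritz_john_pos_iff l_def)
    also have "\<dots> = l\<^sup>2 * (\<Sum>j\<in>UNIV. (u $ Inr j)\<^sup>2 * meval (mpderiv i (g j)) (x_part z))"
      using nonnull by (simp add: sum_distrib_left u_def l_def power_divide)
    finally show ?thesis using nonnull by (simp add: l_def)
  qed
  have "meval (lagrangian f g) = (\<lambda>z. meval f (\<chi> i. z $ Inl i)
      - (\<Sum>j\<in>UNIV. (z $ Inr j * z $ Inr j) * meval (g j) (\<chi> i. z $ Inl i)))"
    by (rule ext) (simp add: lagrangian_def power2_eq_square)
  moreover have "((\<lambda>z. meval f (\<chi> i. z $ Inl i)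
      - (\<Sum>j\<in>UNIV. (z $ Inr j * z $ Inr j) * meval (g j) (\<chi> i. z $ Inl i))) has_derivative
    (\<lambda>k. (\<Sum>i\<in>UNIV. k $ Inl i * meval (mpderiv i f) (\<chi> i. u $ Inl i))
      - (\<Sum>j\<in>UNIV. (u $ Inr j * u $ Inr j) *
            (\<Sum>i\<in>UNIV. k $ Inl i * meval (mpderiv i (g j)) (\<chi> i. u $ Inl i))
          + (u $ Inr j * k $ Inr j + k $ Inr j * u $ Inr j) * meval (g j) (\<chi> i. u $ Inl i)))) (at u)"
    by (intro has_derivative_diff has_derivative_sum has_derivative_mult
        meval_x_block_has_derivative bounded_linear_imp_has_derivative bounded_linear_vec_nth)
  moreover have "(\<Sum>i\<in>UNIV. k $ Inl i * meval (mpderiv i f) (\<chi> i. u $ Inl i))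
      - (\<Sum>j\<in>UNIV. (u $ Inr j * u $ Inr j) *
            (\<Sum>i\<in>UNIV. k $ Inl i * meval (mpderiv i (g j)) (\<chi> i. u $ Inl i))
          + (u $ Inr j * k $ Inr j + k $ Inr j * u $ Inr j) * meval (g j) (\<chi> i. u $ Inl i)) = 0" for k
  proof -
    have "(u $ Inr j * k $ Inr j + k $ Inr j * u $ Inr j) * meval (g j) (x_part z)
        = 2 * k $ Inr j * (u $ Inr j * meval (g j) (x_part z))" for j
      by (simp add: algebra_simps)
    moreover have "(\<Sum>i\<in>UNIV. k $ Inl i * meval (mpderiv i f) (x_part z))
        = (\<Sum>j\<in>UNIV. (u $ Inr j * u $ Inr j) *
            (\<Sum>i\<in>UNIV. k $ Inl i * meval (mpderiv i (g j)) (x_part z)))"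
      unfolding grad sum_distrib_left
      by (subst sum.swap) (simp add: power2_eq_square mult_ac)
    ultimately show ?thesis by (simp only: x compl) simp
  qed
  ultimately have "(meval (lagrangian f g) has_derivative (\<lambda>k. 0)) (at u)" by simp
  then have "meval (mpderiv w (lagrangian f g)) u = 0" for w
    by (rule meval_derivative_unique)
  moreover have "meval (lagrangian f g) u = meval f (x_part z)"
    by (simp add: lagrangian_def x power2_eq_square compl mult.assoc)
  ultimately show ?thesis by (intro image_eqI [of _ _ u]) auto
qed

text \<open>
  The hypothesis disposes of the values at abnormal points, and the values at normal points are
  critical values of one polynomial.
\<close>

lemma countable_fritz_john_values:
  fixes f :: "'n::finite mpoly" and g :: "'m::finite \<Rightarrow> 'n mpoly"
  assumes "finite (meval f ` (crit_pos g \<inter> basic_closed g))"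
  shows "countable ((\<lambda>z. meval f (x_part z)) `
    ({z. x_part z \<in> basic_closed g} \<inter> zero_set (fritz_john_pos f g)))"
proof (rule countable_subset)
  show "(\<lambda>z. meval f (x_part z)) ` ({z. x_part z \<in> basic_closed g} \<inter> zero_set (fritz_john_pos f g))
    \<subseteq> meval f ` (crit_pos g \<inter> basic_closed g)
      \<union> meval (lagrangian f g) ` {u. \<forall>w. meval (mpderiv w (lagrangian f g)) u = 0}"
    using abnormal_point_in_crit_pos normal_point_value_critical by blast
  show "countable (meval f ` (crit_pos g \<inter> basic_closed g)
      \<union> meval (lagrangian f g) ` {u. \<forall>w. meval (mpderiv w (lagrangian f g)) u = 0})"
    by (intro countable_Un countable_finite [OF assms] countable_critical_values)
qed

text \<open>
  The inequalities \<open>g\<^sub>j \<ge> 0\<close> become equations \<open>g\<^sub>j = s\<^sub>j\<^sup>2\<close> with slack variables, and the sum of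
  the squares of all equations cuts out the resulting real algebraic set.
\<close>

definition slack_system :: "'n::finite mpoly \<Rightarrow> ('m::finite \<Rightarrow> 'n mpoly)
    \<Rightarrow> (('n + 'm option) + 'm) mpoly" where
  "slack_system f g = (\<Sum>r\<in>UNIV. mrename Inl (fritz_john_pos f g r) ^ 2)
     + (\<Sum>j\<in>UNIV. (mrename Inl (lift_x (g j)) - mVar (Inr j) ^ 2) ^ 2)"

lemma slack_system_nonneg: "meval (slack_system f g) \<zeta> \<ge> 0"
  by (simp add: slack_system_def sum_nonneg)

lemma slack_system_zero_iff:
  "meval (slack_system f g) \<zeta> = 0 \<longleftrightarrow> (\<chi> i. \<zeta> $ Inl i) \<in> zero_set (fritz_john_pos f g) \<and>
    (\<forall>j. meval (g j) (x_part (\<chi> i. \<zeta> $ Inl i)) = (\<zeta> $ Inr j)\<^sup>2)"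
  by (simp add: slack_system_def add_nonneg_eq_0_iff sum_nonneg sum_nonneg_eq_0_iff zero_set_def)

lemma slack_system_values:
  "(\<lambda>z. meval f (x_part z)) ` ({z. x_part z \<in> basic_closed g} \<inter> zero_set (fritz_john_pos f g))
   = meval (mrename Inl (lift_x f)) ` {\<zeta>. meval (slack_system f g) \<zeta> = 0}" (is "?L = ?R")
proof
  show "?L \<subseteq> ?R"
  proof
    fix v assume "v \<in> ?L"
    then obtain z where z: "x_part z \<in> basic_closed g" "z \<in> zero_set (fritz_john_pos f g)"
      "v = meval f (x_part z)" by auto
    define \<zeta> :: "real ^ (('a + 'b option) + 'b)" where
      "\<zeta> = (\<chi> w. case w of Inl i \<Rightarrow> z $ i | Inr j \<Rightarrow> sqrt (meval (g j) (x_part z)))"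
    have "(\<chi> i. \<zeta> $ Inl i) = z" by (simp add: \<zeta>_def vec_eq_iff)
    moreover have "(\<zeta> $ Inr j)\<^sup>2 = meval (g j) (x_part z)" for j
      using z(1) by (simp add: \<zeta>_def basic_closed_def)
    ultimately show "v \<in> ?R" using z
      by (intro image_eqI [of _ _ \<zeta>]) (simp_all add: slack_system_zero_iff)
  qed
  show "?R \<subseteq> ?L"
  proof
    fix v assume "v \<in> ?R"
    then obtain \<zeta> where \<zeta>: "meval (slack_system f g) \<zeta> = 0"
      "v = meval (mrename Inl (lift_x f)) \<zeta>" by auto
    then show "v \<in> ?L"
      by (intro image_eqI [of _ _ "\<chi> i. \<zeta> $ Inl i"])
         (auto simp: slack_system_zero_iff basic_closed_def)
  qed
qed

lemma deg_le_fritz_john_pos: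
  assumes f: "f \<in> polys_deg_le d" and g: "\<And>j. g j \<in> polys_deg_le d"
  shows "fritz_john_pos f g r \<in> polys_deg_le (d + 2)"
proof -
  have lam: "(lam j ^ 2 :: ('a + 'b option) mpoly) \<in> polys_deg_le 2" for j :: "'b option"
    unfolding lam_def by (intro deg_le_power' [of _ 1] deg_le_mVar) auto
  have lam_times: "lam j ^ 2 * lift_x p \<in> polys_deg_le (d + 2)" if "p \<in> polys_deg_le d"
    for j :: "'b option" and p :: "'a mpoly"
    using that lam unfolding lift_x_eq_mrename
    by (intro deg_le_mult' [of _ 2 _ d] deg_le_mrename) auto
  have deriv: "mpderiv i p \<in> polys_deg_le d" if "p \<in> polys_deg_le d" for i and p :: "'a mpoly"
    by (rule deg_le_mono [OF deg_le_mpderiv [OF that]]) simp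
  have "(1 - (\<Sum>j\<in>UNIV. lam j ^ 2) :: ('a + 'b option) mpoly) \<in> polys_deg_le (d + 2)"
    by (intro deg_le_diff deg_le_sum deg_le_one deg_le_mono [OF lam]) auto
  then show ?thesis
    unfolding fritz_john_pos_def
    by (auto split: sum.split simp del: add_2_eq_Suc' intro!: deg_le_diff deg_le_sum lam_times deriv f g)
qed

lemma deg_le_slack_system:
  assumes f: "f \<in> polys_deg_le d" and g: "\<And>j. g j \<in> polys_deg_le d"
  shows "slack_system f g \<in> polys_deg_le (2 * d + 4)"
  unfolding slack_system_def lift_x_eq_mrename
  by (intro deg_le_add deg_le_sum deg_le_power' [of _ "d + 2"] deg_le_mrename
      deg_le_fritz_john_pos deg_le_diff deg_le_power' [of "mVar _" 1] deg_le_mVar f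
      deg_le_mono [OF g]) auto

text \<open>
  The slack system has degree at most \<open>2 d + 4\<close> in \<open>n + 2 m + 1\<close> variables, so its gradient has
  degree at most \<open>2 d + 3\<close>.
\<close>

lemma fritz_john_values_bound:
  fixes f :: "'n::finite mpoly" and g :: "'m::finite \<Rightarrow> 'n mpoly"
  assumes f: "f \<in> polys_deg_le d" and g: "\<And>j. g j \<in> polys_deg_le d"
    and fin: "finite (meval f ` (crit_pos g \<inter> basic_closed g))"
  defines "V \<equiv> (\<lambda>z. meval f (x_part z)) `
    ({z. x_part z \<in> basic_closed g} \<inter> zero_set (fritz_john_pos f g))"
  shows "finite V \<and> card V \<le> (2 * d + 3) ^ (CARD('n) + 2 * CARD('m) + 1)"
proof (rule finite_if_finite_subsets_card_bdd)
  fix A assume A: "A \<subseteq> V" "finite A"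
  have V: "V = meval (mrename Inl (lift_x f)) ` {\<zeta>. meval (slack_system f g) \<zeta> = 0}"
    unfolding V_def by (rule slack_system_values)
  have "card A \<le> (2 * d + 3) ^ CARD(('n + 'm option) + 'm)"
  proof (rule values_on_zero_set_bound)
    show "slack_system f g \<in> polys_deg_le (2 * d + 3 + 1)"
      using deg_le_slack_system [OF f g] by (simp add: add.commute)
    show "countable (meval (mrename Inl (lift_x f)) ` {\<zeta>. meval (slack_system f g) \<zeta> = 0})"
      using countable_fritz_john_values [OF fin] by (simp only: V [symmetric] V_def)
  qed (use A V in \<open>auto simp: slack_system_nonneg\<close>)
  also have "CARD(('n + 'm option) + 'm) = CARD('n) + 2 * CARD('m) + 1" by simp
  finally show "card A \<le> (2 * d + 3) ^ (CARD('n) + 2 * CARD('m) + 1)" .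
qed

section \<open>Interpolation by a sum of squares\<close>

text \<open>
  Lagrange interpolation at the values of \<open>p\<close>: the square of the basis polynomial at \<open>a\<close> is
  \<open>1\<close> where \<open>p = a\<close> and \<open>0\<close> where \<open>p\<close> takes another of the values, so weighting it with
  \<open>a \<ge> 0\<close> reproduces \<open>p\<close>.
\<close>

lemma interpolating_sos:
  fixes p :: "'v::finite mpoly"
  assumes A: "finite A" "\<And>a. a \<in> A \<Longrightarrow> a \<ge> 0" and p: "p \<in> polys_deg_le d"
    and w: "d * (card A - 1) \<le> w"
  shows "\<exists>q\<in>sos_deg_le w. \<forall>z. meval p z \<in> A \<longrightarrow> meval q z = meval p z"
proof -
  define l where "l = (\<lambda>a. mConst (sqrt a * (\<Prod>b\<in>A - {a}. inverse (a - b)))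
    * (\<Prod>b\<in>A - {a}. p - mConst b))"
  obtain as where as: "set as = A" "distinct as" using finite_distinct_list [OF A(1)] by blast
  define q where "q = (\<Sum>r\<leftarrow>map l as. r ^ 2)"
  have deg: "l a \<in> polys_deg_le w" if "a \<in> A" for a
  proof -
    have "(\<Prod>b\<in>A - {a}. p - mConst b) \<in> polys_deg_le (\<Sum>b\<in>A - {a}. d)"
      by (intro deg_le_prod deg_le_diff p deg_le_mConst)
    moreover have "(\<Sum>b\<in>A - {a}. d) \<le> w" using w that A(1) by (simp add: mult.commute)
    ultimately show ?thesis unfolding l_def
      by (intro deg_le_mult' [of _ 0 _ "\<Sum>b\<in>A - {a}. d"]) auto
  qed
  then have "q \<in> sos_deg_le w"
    unfolding sos_deg_le_def q_def using as(1) by (intro CollectI exI [of _ "map l as"]) auto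
  moreover have "meval q z = meval p z" if z: "meval p z \<in> A" for z
  proof -
    define c where "c = meval p z"
    have c: "c \<in> A" using z by (simp add: c_def)
    have l: "meval (l a) z = sqrt a * ((\<Prod>b\<in>A - {a}. inverse (a - b)) * (\<Prod>b\<in>A - {a}. c - b))" for a
      by (simp add: l_def c_def)
    have other: "meval (l a) z = 0" if "a \<in> A - {c}" for a
    proof -
      have "(\<Prod>b\<in>A - {a}. c - b) = 0"
        using that c A(1) by (intro prod_zero bexI [of _ c]) auto
      then show ?thesis by (simp add: l)
    qed
    have "(\<Prod>b\<in>A - {c}. inverse (c - b)) * (\<Prod>b\<in>A - {c}. c - b) = 1"
      by (subst prod.distrib [symmetric]) (auto intro: prod.neutral)
    then have self: "meval (l c) z = sqrt c" by (simp add: l)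
    have "meval q z = (\<Sum>a\<in>A. (meval (l a) z)\<^sup>2)"
      using as by (simp add: q_def comp_def sum_list_distinct_conv_sum_set)
    also have "\<dots> = (meval (l c) z)\<^sup>2 + (\<Sum>a\<in>A - {c}. (meval (l a) z)\<^sup>2)"
      by (rule sum.remove [OF A(1) c])
    also have "\<dots> = c" using other self A(2) [OF c] by simp
    finally show ?thesis by (simp add: c_def)
  qed
  ultimately show ?thesis by blast
qed

theorem theorem4:
  fixes f :: "'n::finite mpoly"
    and g :: "'m::finite \<Rightarrow> 'n mpoly"
    and d w :: nat
  assumes "f \<in> polys_deg_le d"
    and "\<forall>j. g j \<in> polys_deg_le d"
    and "\<forall>x\<in>basic_closed g. meval f x \<ge> 0"
    and "finite (meval f ` (crit_pos g \<inter> basic_closed g))"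
    and "w = d * (comp_bound (CARD('n) + CARD('m) + 1) (d + 2) (CARD('n) + 2 * CARD('m) + 1) - 1)"
  shows "\<exists>q \<in> sos_deg_le w.
           \<forall>z \<in> {z. x_part z \<in> basic_closed g} \<inter> zero_set (fritz_john_pos f g).
             meval (lift_x f - q) z = 0"
proof -
  define W where "W = {z. x_part z \<in> basic_closed g} \<inter> zero_set (fritz_john_pos f g)"
  define V where "V = (\<lambda>z. meval f (x_part z)) ` W"
  have g: "\<And>j. g j \<in> polys_deg_le d" using assms(2) by simp
  have V: "finite V" "card V \<le> (2 * d + 3) ^ (CARD('n) + 2 * CARD('m) + 1)"
    using fritz_john_values_bound [OF assms(1) g assms(4)] by (simp_all add: V_def W_def)
  have "(2 * d + 3) ^ (CARD('n) + 2 * CARD('m) + 1)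
      \<le> (d + 2) * (2 * d + 3) ^ (CARD('n) + CARD('m) + 1 + (CARD('n) + 2 * CARD('m) + 1) - 1)"
  proof -
    have "(2 * d + 3) ^ (CARD('n) + 2 * CARD('m) + 1)
        \<le> (2 * d + 3) ^ (CARD('n) + CARD('m) + 1 + (CARD('n) + 2 * CARD('m) + 1) - 1)"
      by (rule power_increasing) auto
    also have "\<dots> = 1 * \<dots>" by simp
    also have "\<dots> \<le> (d + 2) * (2 * d + 3) ^ (CARD('n) + CARD('m) + 1 + (CARD('n) + 2 * CARD('m) + 1) - 1)"
      by (rule mult_le_mono1) simp
    finally show ?thesis .
  qed
  also have "\<dots> = comp_bound (CARD('n) + CARD('m) + 1) (d + 2) (CARD('n) + 2 * CARD('m) + 1)"
  proof -
    have "2 * (d + 2) - 1 = 2 * d + 3" by simp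
    then show ?thesis by (simp only: comp_bound_def)
  qed
  finally have "d * (card V - 1) \<le> w"
    unfolding assms(5) using V(2) by (intro mult_le_mono2 diff_le_mono) (rule order_trans)
  moreover have "v \<ge> 0" if "v \<in> V" for v
    using that assms(3) by (auto simp: V_def W_def)
  moreover have "lift_x f \<in> polys_deg_le d"
    unfolding lift_x_eq_mrename by (intro deg_le_mrename assms(1))
  ultimately obtain q where "q \<in> sos_deg_le w"
    "\<forall>z :: real ^ ('n + 'm option). meval (lift_x f) z \<in> V \<longrightarrow> meval q z = meval (lift_x f) z"
    using interpolating_sos [of V "lift_x f" d w] V(1) by blast
  then show ?thesis by (intro bexI [of _ q]) (auto simp: V_def W_def)
qed

end
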